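(* Let $p$ be a prime and $n$ a natural number with $p>(n+1)^{n+1}+1$. Then the group of flows construction gives a one-to-one correspondence between powerful left nilpotent pre-Lie rings of cardinality $p^{n}$ and left braces of cardinality $p^{n}$ whose adjoint group is powerful, where the brace corresponding to a pre-Lie ring $(A,+,\cdot)$ is $(A,+,\circ)$ with the same additive group. That is: the group-of-flows brace of every powerful left nilpotent pre-Lie ring of cardinality $p^{n}$ has powerful adjoint group; every brace of cardinality $p^{n}$ with powerful adjoint group arises in this way from a powerful left nilpotent (indeed strongly nilpotent) pre-Lie ring with the same additive group; and this pairing is bijective.
   Context: A (left) brace is a set $A$ with operations $+,\circ$ such that $(A,+)$ is an abelian group, $(A,\circ)$ is a group (the adjoint group), and $a\circ(b+c)+a=a\circ b+a\circ c$. A pre-Lie ring is an abelian group with a bi-additive $\cdot$ satisfying $(x\cdot y)\cdot z-x\cdot(y\cdot z)=(y\cdot x)\cdot z-y\cdot(x\cdot z)$; it is left nilpotent if for some $m$ all $a_1\cdot(a_2\cdot(\cdots\cdot a_m))$ vanish, and powerful if $a\cdot b-b\cdot a\in pA$ for all $a,b$ (for $p>2$). Group of flows: with $L_a(b)=a\cdot b$, $e^{L_a}(b)=\sum_{k\ge0}\frac1{k!}L_a^{k}(b)$, $W(a)=\sum_{k\ge1}\frac1{k!}L_a^{k-1}(a)$, $\Omega=W^{-1}$, and $a\circ b=a+e^{L_{\Omega(a)}}(b)$; for such $A$ this gives a brace $(A,+,\circ)$. A finite $p$-group $G$ ($p>2$) is powerful if $G'\le G^{p}=\langle g^{p}:g\in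 G\rangle$. *)

theory Defs
  imports "HOL-Algebra.Algebra"
begin

definition nsm :: "nat \<Rightarrow> 'a::ab_group_add \<Rightarrow> 'a" where
  "nsm k y = (\<Sum>_<k. y)"

text \<open>x / k: the unique y with k*y = x (meaningful when multiplication by k is bijective).\<close>
definition ndiv :: "'a::ab_group_add \<Rightarrow> nat \<Rightarrow> 'a" where
  "ndiv x k = (THE y. nsm k y = x)"

definition pre_lie :: "('a::ab_group_add \<Rightarrow> 'a \<Rightarrow> 'a) \<Rightarrow> bool" where
  "pre_lie mul \<longleftrightarrow>
     (\<forall>x y z. mul (x + y) z = mul x z + mul y z) \<and>
     (\<forall>x y z. mul x (y + z) = mul x y + mul x z) \<and>
     (\<forall>x y z. mul (mul x y) z - mul x (mul y z) = mul (mul y x) z - mul y (mul x z))"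

fun rnest :: "('a \<Rightarrow> 'a \<Rightarrow> 'a) \<Rightarrow> 'a list \<Rightarrow> 'a" where
  "rnest mul [] = undefined"
| "rnest mul [a] = a"
| "rnest mul (a # b # as) = mul a (rnest mul (b # as))"

definition left_nilpotent :: "('a::ab_group_add \<Rightarrow> 'a \<Rightarrow> 'a) \<Rightarrow> bool" where
  "left_nilpotent mul \<longleftrightarrow> (\<exists>m>0. \<forall>as. length as = m \<longrightarrow> rnest mul as = 0)"

inductive prod_len :: "('a \<Rightarrow> 'a \<Rightarrow> 'a) \<Rightarrow> nat \<Rightarrow> 'a \<Rightarrow> bool" for mul where
  single: "prod_len mul 1 x"
| prod: "prod_len mul i x \<Longrightarrow> prod_len mul j y \<Longrightarrow> prod_len mul (i + j) (mul x y)"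

definition strongly_nilpotent :: "('a::ab_group_add \<Rightarrow> 'a \<Rightarrow> 'a) \<Rightarrow> bool" where
  "strongly_nilpotent mul \<longleftrightarrow> (\<exists>m>0. \<forall>x. prod_len mul m x \<longrightarrow> x = 0)"

definition powerful_pre_lie :: "nat \<Rightarrow> ('a::ab_group_add \<Rightarrow> 'a \<Rightarrow> 'a) \<Rightarrow> bool" where
  "powerful_pre_lie p mul \<longleftrightarrow> (\<forall>a b. \<exists>c. mul a b - mul b a = nsm p c)"

definition Lpow :: "('a \<Rightarrow> 'a \<Rightarrow> 'a) \<Rightarrow> 'a \<Rightarrow> nat \<Rightarrow> 'a \<Rightarrow> 'a" where
  "Lpow mul a k = (mul a ^^ k)"

text \<open>e^{L_a}(b) = sum_{k>=0} L_a^k(b)/k!; the terms vanish from the first k with L_a^k(b) = 0 on,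
  so the series is the finite sum up to that index.\<close>
definition expL :: "('a::ab_group_add \<Rightarrow> 'a \<Rightarrow> 'a) \<Rightarrow> 'a \<Rightarrow> 'a \<Rightarrow> 'a" where
  "expL mul a b = (\<Sum>k < (LEAST m. Lpow mul a m b = 0). ndiv (Lpow mul a k b) (fact k))"

definition Wf :: "('a::ab_group_add \<Rightarrow> 'a \<Rightarrow> 'a) \<Rightarrow> 'a \<Rightarrow> 'a" where
  "Wf mul a = (\<Sum>j < (LEAST m. Lpow mul a m a = 0). ndiv (Lpow mul a j a) (fact (Suc j)))"

definition Omega :: "('a::ab_group_add \<Rightarrow> 'a \<Rightarrow> 'a) \<Rightarrow> 'a \<Rightarrow> 'a" where
  "Omega mul = Hilbert_Choice.inv (Wf mul)"

definition flow_circ :: "('a::ab_group_add \<Rightarrow> 'a \<Rightarrow> 'a) \<Rightarrow> 'a \<Rightarrow> 'a \<Rightarrow> 'a" where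
  "flow_circ mul a b = a + expL mul (Omega mul a) b"

definition adj_group :: "('a \<Rightarrow> 'a \<Rightarrow> 'a) \<Rightarrow> 'a monoid" where
  "adj_group circ = \<lparr>carrier = UNIV, monoid.mult = circ,
      monoid.one = (THE e. \<forall>x. circ e x = x \<and> circ x e = x)\<rparr>"

definition is_brace :: "('a::ab_group_add \<Rightarrow> 'a \<Rightarrow> 'a) \<Rightarrow> bool" where
  "is_brace circ \<longleftrightarrow> group (adj_group circ) \<and>
     (\<forall>a b c. circ a (b + c) + a = circ a b + circ a c)"

definition powerful_group :: "nat \<Rightarrow> ('g, 'b) monoid_scheme \<Rightarrow> bool" where
  "powerful_group p G \<longleftrightarrow>
     derived G (carrier G) \<subseteq> generate G {g [^]\<^bsub>G\<^esub> p | g. g \<in> carrier G}"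

end

theory Submission
  imports Defs "HOL-Computational_Algebra.Formal_Power_Series" "HOL-Number_Theory.Cong"
    "HOL-Library.Product_Plus"
begin

text \<open>
  A pre-Lie product on \<open>A\<close> is the same as a Lie ring of affine vector fields
  \<open>b \<mapsto> a + a \<cdot> b\<close> with one field for each \<open>a\<close>, and a brace is the same as a group of affine maps
  \<open>b \<mapsto> a + \<lambda>\<^sub>a(b)\<close> with one map for each \<open>a\<close>. Left nilpotency of the product, and the fact that
  a \<open>p\<close>-group acts unipotently on a \<open>p\<close>-group, put both into an associative ring filtered by a chain
  of length at most \<open>n < p\<close>, where the truncated exponential is a bijection; the group of flows is
  the image of the Lie ring. So everything follows from Lazard's correspondence.

  That the exponential of a Lie ring is a group: the logarithmic derivative of
  \<open>exp (t x) exp (t y) = exp (z t)\<close> has Lie coefficients and determines the coefficients of \<open>z\<close>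
  recursively. That the logarithm of a group \<open>G\<close> is a Lie ring: if \<open>exp (s\<^sup>k d + \<dots>) \<in> G\<close> for all
  integers \<open>s\<close>, then \<open>exp d \<in> G\<close>; this is applied to \<open>exp (s x) exp (s y)\<close> and to the commutator of
  \<open>exp (s x)\<close> and \<open>exp (s y)\<close>. The same two principles applied to \<open>p L\<close> show that the Lie ring \<open>L\<close>
  is powerful iff the group is. Finally, a powerful pre-Lie product is commutative, hence
  associative, modulo \<open>p\<close>, so that long products are divisible by high powers of \<open>p\<close>.
\<close>

section \<open>Truncated exponentials in filtered rings\<close>

text \<open>The obstacle is that the correspondence is needed with coefficients in Z/p^n, where the
  Campbell-Hausdorff series would require control of its denominators and a proof that its terms are
  brackets. No coefficient of that series beyond the lowest terms is ever computed. To speak of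
  degrees without a free Lie ring, elements are replaced by power series in t whose coefficient at
  t^i lies in the i-th step of the filtration. These series form a filtered ring of the same kind,
  so each lemma on exponentials serves both for elements and for paths. The parameter s of a path
  can only be an integer, so terms of different degree are separated by comparing the path at s and
  at 2 s. This requires 2^j - 2^k to be prime to p for 0 < k < j \<le> n, which is the origin of the
  bound 2^n < p; the same bound makes k! invertible for k \<le> n. Vector fields and affine maps are
  identified throughout by their value at the origin, the point (1, 0) of int x A.\<close>

definition rcp :: "nat \<Rightarrow> nat \<Rightarrow> nat" where
  "rcp M k = (SOME r. [k * r = 1] (mod M))"

text \<open>\<open>rfact M k\<close> stands for \<open>1 / k!\<close> modulo \<open>M\<close>; it is meaningful only if \<open>k!\<close> is prime to \<open>M\<close>.\<close>

primrec rfact :: "nat \<Rightarrow> nat \<Rightarrow> nat" where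
  "rfact M 0 = 1"
| "rfact M (Suc k) = rcp M (Suc k) * rfact M k"

text \<open>The divided power x^k / k!, with an integer inverse of k! because the ring itself need
  not contain 1 / k!.\<close>

definition dpow :: "nat \<Rightarrow> 'r::ring_1 \<Rightarrow> nat \<Rightarrow> 'r" where
  "dpow M x k = of_nat (rfact M k) * x ^ k"

definition texp :: "nat \<Rightarrow> nat \<Rightarrow> 'r::ring_1 \<Rightarrow> 'r" where
  "texp M n x = (\<Sum>k\<le>n. dpow M x k)"

lemma rcp_cong: "coprime k M \<Longrightarrow> [k * rcp M k = 1] (mod M)"
  unfolding rcp_def by (rule someI_ex) (metis cong_solve_coprime_nat mult.commute One_nat_def)

lemma of_nat_left_commute: "x * (of_nat c * y) = of_nat c * (x * (y :: 'r::ring_1))"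
  by (metis mult.assoc mult_of_nat_commute)

lemma of_nat_mult_mult: "(of_nat a * x) * (of_nat b * y) = of_nat (a * b) * (x * (y :: 'r::ring_1))"
  by (metis mult.assoc of_nat_left_commute of_nat_mult)

locale plus_subgroup =
  fixes S :: "'r::ab_group_add set"
  assumes zero_mem: "0 \<in> S"
    and add_mem: "x \<in> S \<Longrightarrow> y \<in> S \<Longrightarrow> x + y \<in> S"
    and uminus_mem: "x \<in> S \<Longrightarrow> - x \<in> S"
begin

lemma diff_mem: "x \<in> S \<Longrightarrow> y \<in> S \<Longrightarrow> x - y \<in> S"
  using add_mem[of x "- y"] uminus_mem[of y] by simp

lemma sum_mem: "(\<And>i. i \<in> I \<Longrightarrow> f i \<in> S) \<Longrightarrow> sum f I \<in> S"
  by (induction I rule: infinite_finite_induct) (auto simp: zero_mem add_mem)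

end

lemma plus_subgroup_of_nat_mult:
  fixes x :: "'r::ring_1"
  assumes "plus_subgroup S" "x \<in> S" shows "of_nat c * x \<in> S"
proof -
  interpret plus_subgroup S by fact
  show ?thesis by (induction c) (auto simp: zero_mem add_mem assms distrib_right)
qed

text \<open>The model is the ring of additive endomorphisms of int x A. Its unit has infinite order,
  so torsion is imposed on \<open>F 1\<close> and not on \<open>F 0\<close>.\<close>

locale filtered_ring =
  fixes F :: "nat \<Rightarrow> 'r::ring_1 set" and p n :: nat
  assumes prime_p: "Factorial_Ring.prime p"
    and n_small: "2 ^ n < p"
    and F_subgroup: "plus_subgroup (F k)"
    and F_Suc: "F (Suc k) \<subseteq> F k"
    and F_one: "1 \<in> F 0"
    and F_mult: "x \<in> F i \<Longrightarrow> y \<in> F j \<Longrightarrow> x * y \<in> F (i + j)"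
    and F_top: "x \<in> F (Suc n) \<Longrightarrow> x = 0"
    and F_torsion: "x \<in> F (Suc 0) \<Longrightarrow> of_nat (p ^ n) * x = 0"
begin

abbreviation "M \<equiv> p ^ n"
abbreviation "E \<equiv> dpow M"
abbreviation "EXP \<equiv> texp M n"

lemmas F_zero = plus_subgroup.zero_mem[OF F_subgroup]
lemmas F_add = plus_subgroup.add_mem[OF F_subgroup]
lemmas F_uminus = plus_subgroup.uminus_mem[OF F_subgroup]
lemmas F_diff = plus_subgroup.diff_mem[OF F_subgroup]
lemmas F_sum = plus_subgroup.sum_mem[OF F_subgroup]
lemmas F_of_nat_mult = plus_subgroup_of_nat_mult[OF F_subgroup]

lemma F_antimono: "x \<in> F j \<Longrightarrow> i \<le> j \<Longrightarrow> x \<in> F i"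
  using lift_Suc_antimono_le[of F i j] F_Suc by blast

lemma F_posD: "x \<in> F j \<Longrightarrow> 0 < j \<Longrightarrow> x \<in> F (Suc 0)"
  by (erule F_antimono) simp

lemma F_0I: "x \<in> F j \<Longrightarrow> x \<in> F 0"
  by (erule F_antimono) simp

lemma F_multI: "x \<in> F i \<Longrightarrow> y \<in> F j \<Longrightarrow> k \<le> i + j \<Longrightarrow> x * y \<in> F k"
  using F_mult F_antimono by blast

lemma F_mult_left: "x \<in> F 0 \<Longrightarrow> y \<in> F j \<Longrightarrow> x * y \<in> F j"
  using F_mult[of x 0 y j] by simp

lemma F_mult_right: "x \<in> F j \<Longrightarrow> y \<in> F 0 \<Longrightarrow> x * y \<in> F j"
  using F_mult[of x j y 0] by simp

lemma F_zeroD: "x \<in> F k \<Longrightarrow> n < k \<Longrightarrow> x = 0"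
  using F_antimono F_top Suc_leI by blast

lemma F_power: "x \<in> F (Suc 0) \<Longrightarrow> x ^ k \<in> F k"
proof (induction k)
  case (Suc k) then show ?case using F_mult[of x 1 "x ^ k" k] by simp
qed (simp add: F_one)

lemma dpow_mem: "x \<in> F (Suc 0) \<Longrightarrow> E x k \<in> F k"
  by (simp add: dpow_def F_of_nat_mult F_power)

lemma dpow_top: "x \<in> F (Suc 0) \<Longrightarrow> n < k \<Longrightarrow> E x k = 0"
  using dpow_mem F_zeroD by blast

lemma n_less_p: "n < p"
  using n_small less_exp order.strict_trans by blast

lemma coprime_small: "0 < k \<Longrightarrow> k < p \<Longrightarrow> coprime k p"
  using prime_p by (metis coprime_commute nat_dvd_not_less prime_imp_coprime)

lemma of_nat_cong_mult:
  assumes "x \<in> F (Suc 0)" "[a = b] (mod M)" shows "of_nat a * x = of_nat b * x"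
proof -
  have *: "of_nat (c + k * M) * x = of_nat c * x" for c k
    using F_torsion[OF assms(1)] by (simp add: distrib_right mult.assoc)
  obtain k l where "a + k * M = b + l * M"
    using assms(2) by (metis cong_iff_lin_nat mult.commute)
  then show ?thesis using * by metis
qed

lemma rcp_of_nat_mult:
  assumes "x \<in> F (Suc 0)" "coprime k p"
  shows "of_nat (rcp M k) * (of_nat k * x) = x" "of_nat k * (of_nat (rcp M k) * x) = x"
proof -
  have "coprime k M" using assms(2) by simp
  then have "of_nat (k * rcp M k) * x = of_nat 1 * x"
    by (rule of_nat_cong_mult[OF assms(1) rcp_cong])
  then show "of_nat k * (of_nat (rcp M k) * x) = x" by (simp add: mult.assoc)
  then show "of_nat (rcp M k) * (of_nat k * x) = x"
    by (metis mult.assoc mult_of_nat_commute)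
qed

lemma of_nat_mult_cancel:
  assumes "x \<in> F (Suc 0)" "y \<in> F (Suc 0)" "coprime k p" "of_nat k * x = of_nat k * y" shows "x = y"
  using rcp_of_nat_mult assms by metis

lemma of_nat_mult_mem_iff:
  assumes "plus_subgroup S" "x \<in> F (Suc 0)" "coprime k p"
  shows "of_nat k * x \<in> S \<longleftrightarrow> x \<in> S"
  using rcp_of_nat_mult[OF assms(2,3)] plus_subgroup_of_nat_mult[OF assms(1)] by metis

lemma dpow_0 [simp]: "dpow K x 0 = 1"
  by (simp add: dpow_def)

text \<open>For k \<ge> n both sides vanish, so the recursion holds for every k, even where k + 1 is
  divisible by p. The identities for exponentials are derived from it instead of from binomial
  coefficients.\<close>

lemma dpow_Suc:
  assumes "x \<in> F (Suc 0)" shows "of_nat (Suc k) * E x (Suc k) = x * E x k"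
proof (cases "Suc k \<le> n")
  case True
  then have c: "coprime (Suc k) p" using coprime_small n_less_p by simp
  have x: "x ^ Suc k \<in> F (Suc 0)" using F_posD[OF F_power[OF assms]] by blast
  have "of_nat (Suc k) * E x (Suc k)
      = of_nat (Suc k) * (of_nat (rcp M (Suc k)) * (of_nat (rfact M k) * x ^ Suc k))"
    by (simp only: dpow_def rfact.simps of_nat_mult mult.assoc)
  also have "\<dots> = of_nat (rfact M k) * x ^ Suc k"
    using rcp_of_nat_mult(2)[OF F_of_nat_mult[OF x] c] .
  also have "\<dots> = x * E x k"
    by (simp add: dpow_def of_nat_left_commute)
  finally show ?thesis .
next
  case False
  have "x * E x k \<in> F (Suc k)" using F_mult[OF assms dpow_mem[OF assms]] by simp
  then have "x * E x k = 0" using F_zeroD False by simp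
  then show ?thesis using dpow_top[OF assms] False by simp
qed

lemma dpow_1: "x \<in> F (Suc 0) \<Longrightarrow> E x (Suc 0) = x"
  using dpow_Suc[of x 0] by simp

lemma dpow_commute: "x * y = y * x \<Longrightarrow> dpow K x k * y = y * dpow K x k"
  unfolding dpow_def
  by (metis (no_types) mult.assoc mult_of_nat_commute power_commuting_commutes)

lemma texp_commute: "x * y = y * x \<Longrightarrow> texp K m x * y = y * texp K m x"
  unfolding texp_def by (simp add: sum_distrib_left sum_distrib_right dpow_commute)

lemma dpow_Suc': "x \<in> F (Suc 0) \<Longrightarrow> of_nat (Suc k) * E x (Suc k) = E x k * x"
  by (simp only: dpow_Suc) (simp add: dpow_commute)

text \<open>The products with i + j > n lie in \<open>F (i + j)\<close> and vanish, which cuts the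
  square down to a triangle.\<close>

lemma filtered_Cauchy_product:
  assumes "\<And>i. \<alpha> i \<in> F i" "\<And>i. \<beta> i \<in> F i"
  shows "(\<Sum>i\<le>n. \<alpha> i) * (\<Sum>j\<le>n. \<beta> j) = (\<Sum>k\<le>n. \<Sum>i\<le>k. \<alpha> i * \<beta> (k - i))"
proof -
  have "(\<Sum>i\<le>n. \<alpha> i) * (\<Sum>j\<le>n. \<beta> j) = (\<Sum>(i,j)\<in>{..n}\<times>{..n}. \<alpha> i * \<beta> j)"
    by (simp add: sum_product sum.cartesian_product)
  also have "\<dots> = (\<Sum>(i,j)\<in>{(i,j). i + j \<le> n}. \<alpha> i * \<beta> j)"
  proof (rule sum.mono_neutral_right)
    show "\<forall>x\<in>{..n} \<times> {..n} - {(i, j). i + j \<le> n}. (case x of (i, j) \<Rightarrow> \<alpha> i * \<beta> j) = 0"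
    proof
      fix x assume "x \<in> {..n} \<times> {..n} - {(i, j). i + j \<le> n}"
      then obtain i j where "x = (i, j)" "n < i + j" by (auto simp: not_le)
      then show "(case x of (i, j) \<Rightarrow> \<alpha> i * \<beta> j) = 0" using F_zeroD[OF F_mult[OF assms]] by simp
    qed
  qed auto
  also have "\<dots> = (\<Sum>k\<le>n. \<Sum>i\<le>k. \<alpha> i * \<beta> (k - i))"
    by (rule sum.triangle_reindex_eq)
  finally show ?thesis .
qed

lemma texp_zero [simp]: "texp K m 0 = 1"
proof -
  have "texp K m 0 = (\<Sum>k\<le>m. if k = 0 then 1 else 0)"
    unfolding texp_def by (intro sum.cong) (auto simp: dpow_def power_0_left)
  then show ?thesis by simp
qed

text \<open>Both sides satisfy (k + 1) C (k + 1) = (x + y) C k, and k + 1 can be cancelled as long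
  as it is at most n.\<close>

lemma dpow_add:
  assumes "x \<in> F (Suc 0)" "y \<in> F (Suc 0)" and xy: "x * y = y * x"
  shows "(\<Sum>i\<le>k. E x i * E y (k - i)) = E (x + y) k"
proof (induction k)
  case (Suc k)
  define C where "C m = (\<Sum>i\<le>m. E x i * E y (m - i))" for m
  have "of_nat (Suc k) * C (Suc k)
     = (\<Sum>i\<le>Suc k. of_nat i * (E x i * E y (Suc k - i)))
       + (\<Sum>i\<le>Suc k. of_nat (Suc k - i) * (E x i * E y (Suc k - i)))"
    unfolding C_def sum_distrib_left sum.distrib[symmetric]
    by (intro sum.cong) (auto simp: distrib_right[symmetric] of_nat_add[symmetric] simp del: of_nat_add)
  also have "(\<Sum>i\<le>Suc k. of_nat i * (E x i * E y (Suc k - i)))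
      = (\<Sum>i\<le>k. (of_nat (Suc i) * E x (Suc i)) * E y (k - i))"
    by (simp only: sum.atMost_Suc_shift) (simp add: mult.assoc)
  also have "\<dots> = x * C k"
    unfolding C_def dpow_Suc[OF assms(1)] by (simp add: sum_distrib_left mult.assoc)
  also have "(\<Sum>i\<le>Suc k. of_nat (Suc k - i) * (E x i * E y (Suc k - i)))
      = (\<Sum>i\<le>k. E x i * (of_nat (Suc (k - i)) * E y (Suc (k - i))))"
    by (simp add: Suc_diff_le of_nat_left_commute del: of_nat_Suc of_nat_diff)
  also have "\<dots> = C k * y"
    unfolding C_def dpow_Suc'[OF assms(2)] by (simp add: sum_distrib_right mult.assoc)
  finally have "of_nat (Suc k) * C (Suc k) = x * C k + C k * y" .
  moreover have "C k = E (x + y) k" using Suc by (simp add: C_def)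
  ultimately have "of_nat (Suc k) * C (Suc k) = x * E (x + y) k + E (x + y) k * y"
    by simp
  also have "E (x + y) k * y = y * E (x + y) k"
    by (rule dpow_commute) (simp add: algebra_simps xy)
  finally have eq: "of_nat (Suc k) * C (Suc k) = of_nat (Suc k) * E (x + y) (Suc k)"
    by (simp only: dpow_Suc[OF F_add[OF assms(1,2)]] distrib_right)
  have C: "C (Suc k) \<in> F (Suc k)"
    unfolding C_def
    by (intro F_sum) (metis F_mult[OF dpow_mem[OF assms(1)] dpow_mem[OF assms(2)]] atMost_iff le_add_diff_inverse)
  have "C (Suc k) = E (x + y) (Suc k)"
  proof (cases "Suc k \<le> n")
    case True
    then show ?thesis
      using of_nat_mult_cancel[OF _ _ coprime_small eq] C dpow_mem[OF F_add[OF assms(1,2)], of "Suc k"]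
        F_antimono n_less_p by simp
  next
    case False
    then show ?thesis using F_zeroD[OF C] dpow_top[OF F_add[OF assms(1,2)], of "Suc k"] by simp
  qed
  then show ?case by (simp only: C_def)
qed simp

lemma texp_add:
  assumes "x \<in> F (Suc 0)" "y \<in> F (Suc 0)" "x * y = y * x"
  shows "EXP (x + y) = EXP x * EXP y"
  unfolding texp_def
  using filtered_Cauchy_product[OF dpow_mem[OF assms(1)] dpow_mem[OF assms(2)]] dpow_add[OF assms]
  by simp

lemma texp_minus: "x \<in> F (Suc 0) \<Longrightarrow> EXP x * EXP (- x) = 1" "x \<in> F (Suc 0) \<Longrightarrow> EXP (- x) * EXP x = 1"
  using texp_add[of x "- x"] texp_add[of "- x" x] F_uminus by auto

lemma texp_of_nat_mult: "x \<in> F (Suc 0) \<Longrightarrow> EXP (of_nat c * x) = EXP x ^ c"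
proof (induction c)
  case (Suc c)
  have "EXP (of_nat (Suc c) * x) = EXP (x + of_nat c * x)" by (simp add: distrib_right)
  also have "\<dots> = EXP x * EXP (of_nat c * x)"
    using Suc.prems F_of_nat_mult by (intro texp_add) (auto simp: mult.assoc mult_of_nat_commute)
  finally show ?case using Suc by simp
qed simp

lemma texp_mem: "x \<in> F (Suc 0) \<Longrightarrow> EXP x \<in> F 0"
  unfolding texp_def using F_0I[OF dpow_mem] by (intro F_sum) blast

section \<open>Bijectivity of the exponential from \<open>F 1\<close> onto 1 +
  \<open>F 1\<close>\<close>

lemma texp_expand:
  assumes "x \<in> F j" "0 < j" shows "EXP x - 1 - x \<in> F (2 * j)" "EXP x - 1 \<in> F j"
proof -
  have x: "x \<in> F (Suc 0)" using F_posD[OF assms] .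
  have pow: "E x k \<in> F (k * j)" for k
  proof -
    have "x ^ k \<in> F (k * j)"
      by (induction k) (use F_mult[OF assms(1)] F_one in auto)
    then show ?thesis by (simp add: dpow_def F_of_nat_mult)
  qed
  show "EXP x - 1 - x \<in> F (2 * j)"
  proof (cases n)
    case 0
    then have "x = 0" using x F_top by simp
    then show ?thesis by (simp add: F_zero)
  next
    case (Suc m)
    have "EXP x = 1 + (x + (\<Sum>k<m. E x (Suc (Suc k))))"
      unfolding texp_def Suc
      by (simp only: sum.atMost_shift dpow_0 lessThan_Suc_atMost) (simp add: dpow_1[OF x] sum.lessThan_Suc_shift flip: Suc)
    then have "EXP x - 1 - x = (\<Sum>k<m. E x (Suc (Suc k)))" by (simp add: algebra_simps)
    also have "\<dots> \<in> F (2 * j)"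
      by (intro F_sum) (rule F_antimono[OF pow], simp)
    finally show ?thesis .
  qed
  then have "(EXP x - 1 - x) + x \<in> F j"
    by (intro F_add assms(1)) (erule F_antimono, simp)
  then show "EXP x - 1 \<in> F j" by simp
qed

lemma texp_minus_one_mem: "x \<in> F (Suc 0) \<Longrightarrow> EXP x - 1 \<in> F (Suc 0)"
  using texp_expand(2) by simp

text \<open>Telescoping produces terms with one factor x - y, and an exponent of at least 2 leaves a
  further factor from \<open>F 1\<close> in each of them.\<close>

lemma power_diff_mem:
  assumes "x \<in> F (Suc 0)" "x - y \<in> F j" "0 < j" "y \<in> F (Suc 0)"
  shows "x ^ Suc (Suc k) - y ^ Suc (Suc k) \<in> F (Suc j)"
proof -
  have "x ^ Suc k - y ^ Suc k \<in> F j" for k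
  proof (induction k)
    case (Suc k)
    have "x ^ Suc (Suc k) - y ^ Suc (Suc k) = x * (x ^ Suc k - y ^ Suc k) + (x - y) * y ^ Suc k"
      by (simp add: algebra_simps)
    moreover have "x \<in> F 0" "y ^ Suc k \<in> F 0"
      using F_0I[OF assms(1)] F_0I[OF F_power[OF assms(4)]] by blast+
    ultimately show ?case using Suc assms F_mult_left F_mult_right F_add by metis
  qed (use assms in simp)
  note * = this[of k]
  have "x ^ Suc (Suc k) - y ^ Suc (Suc k) = x * (x ^ Suc k - y ^ Suc k) + (x - y) * y ^ Suc k"
    by (simp add: algebra_simps)
  moreover have "y ^ Suc k \<in> F (Suc 0)" using F_posD[OF F_power[OF assms(4)]] by blast
  ultimately show ?thesis
    using F_add F_multI[OF assms(1) *] F_multI[OF assms(2)] by auto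
qed

text \<open>To first order the exponential preserves differences. Injectivity, surjectivity and
  every comparison of leading terms follow from this by climbing the filtration.\<close>

lemma texp_diff_mem:
  assumes "x \<in> F (Suc 0)" "y \<in> F (Suc 0)" "x - y \<in> F j" "0 < j"
  shows "EXP x - EXP y - (x - y) \<in> F (Suc j)"
proof (cases n)
  case 0
  then have "x = 0" "y = 0" using assms F_top by simp_all
  then show ?thesis by (simp add: F_zero)
next
  case (Suc m)
  have *: "EXP z = 1 + (z + (\<Sum>k<m. E z (Suc (Suc k))))" if "z \<in> F (Suc 0)" for z
    unfolding texp_def Suc
    by (simp only: sum.atMost_shift dpow_0 lessThan_Suc_atMost) (simp add: dpow_1[OF that] sum.lessThan_Suc_shift flip: Suc)
  have "EXP x - EXP y - (x - y) = (\<Sum>k<m. of_nat (rfact M (Suc (Suc k))) * (x ^ Suc (Suc k) - y ^ Suc (Suc k)))"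
    by (simp add: *[OF assms(1)] *[OF assms(2)] dpow_def sum_subtractf right_diff_distrib del: power_Suc)
  also have "\<dots> \<in> F (Suc j)"
    by (intro F_sum F_of_nat_mult power_diff_mem assms)
  finally show ?thesis .
qed

lemma texp_diff_mem_iff:
  assumes "x \<in> F (Suc 0)" "y \<in> F (Suc 0)"
  shows "EXP x - EXP y \<in> F j \<longleftrightarrow> x - y \<in> F j"
proof
  assume "x - y \<in> F j"
  show "EXP x - EXP y \<in> F j"
  proof (cases "0 < j")
    case True
    have "(EXP x - EXP y - (x - y)) + (x - y) \<in> F j"
      using texp_diff_mem[OF assms \<open>x - y \<in> F j\<close> True] \<open>x - y \<in> F j\<close> F_Suc F_add by blast
    then show ?thesis by simp
  next
    case False
    then show ?thesis using F_diff[OF texp_mem[OF assms(1)] texp_mem[OF assms(2)]] by (simp add: not_le)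
  qed
next
  assume e: "EXP x - EXP y \<in> F j"
  have "x - y \<in> F i" if "i \<le> j" for i
    using that
  proof (induction i)
    case 0
    show ?case using F_0I[OF F_diff[OF assms]] .
  next
    case (Suc i)
    show ?case
    proof (cases i)
      case 0
      then show ?thesis using F_diff assms by simp
    next
      case (Suc i')
      have "EXP x - EXP y - (x - y) \<in> F (Suc i)"
        using texp_diff_mem[OF assms Suc.IH] Suc.prems Suc by simp
      from F_diff[OF F_antimono[OF e Suc.prems] this] show ?thesis by simp
    qed
  qed
  then show "x - y \<in> F j" by simp
qed

lemma texp_inj: "x \<in> F (Suc 0) \<Longrightarrow> y \<in> F (Suc 0) \<Longrightarrow> EXP x = EXP y \<Longrightarrow> x = y"
  using texp_diff_mem_iff[of x y "Suc n"] F_top[of "x - y"] F_zero by auto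

lemma texp_surj:
  assumes "g - 1 \<in> F (Suc 0)" obtains x where "x \<in> F (Suc 0)" "EXP x = g"
proof -
  have "\<exists>x\<in>F (Suc 0). EXP x - g \<in> F (Suc k)" for k
  proof (induction k)
    case 0
    show ?case using F_uminus[OF assms] by (intro bexI[of _ 0]) (auto simp: F_zero)
  next
    case (Suc k)
    then obtain x where x: "x \<in> F (Suc 0)" "EXP x - g \<in> F (Suc k)" by blast
    \<comment> \<open>A Newton step: subtracting the error of x moves the error one step deeper into
      the filtration.\<close>
    define y where "y = x - (EXP x - g)"
    have y: "y \<in> F (Suc 0)" unfolding y_def using F_diff[OF x(1) F_posD[OF x(2)]] by simp
    have "y - x \<in> F (Suc k)" using F_uminus[OF x(2)] by (simp add: y_def)
    then have "EXP y - EXP x - (y - x) \<in> F (Suc (Suc k))" by (rule texp_diff_mem[OF y x(1)]) simp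
    then show ?case using y by (intro bexI[of _ y]) (simp_all add: y_def)
  qed
  then obtain x where "x \<in> F (Suc 0)" "EXP x - g \<in> F (Suc n)" by blast
  then show thesis using F_top that by force
qed

lemma texp_mult_surj:
  assumes "x \<in> F (Suc 0)" "y \<in> F (Suc 0)" obtains z where "z \<in> F (Suc 0)" "EXP z = EXP x * EXP y"
proof -
  have "EXP x * EXP y - 1 = (EXP x - 1) * EXP y + (EXP y - 1)" by (simp add: algebra_simps)
  also have "\<dots> \<in> F (Suc 0)"
    by (intro F_add F_mult_right texp_mem texp_minus_one_mem assms)
  finally show thesis using texp_surj that by blast
qed

section \<open>Conjugation and derivations\<close>

lemma conj_power:
  fixes g h y :: 'r
  assumes "h * g = 1" shows "(g * y * h) ^ k * g = g * y ^ k"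
  using assms by (induction k) (auto simp: mult.assoc, metis mult.assoc mult.right_neutral mult_1 power_commutes)

lemma texp_conj:
  fixes g h y :: 'r
  assumes "h * g = 1" "g * h = 1" shows "EXP (g * y * h) = g * EXP y * h"
proof -
  have "(g * y * h) ^ k = g * y ^ k * h" for k
    using conj_power[OF assms(1), of y k] assms(2) by (metis mult.assoc mult.right_neutral)
  then have "E (g * y * h) k = g * E y k * h" for k
    unfolding dpow_def by (metis mult.assoc mult_of_nat_commute)
  then show ?thesis by (simp add: texp_def sum_distrib_left sum_distrib_right)
qed

text \<open>The derivation formula \<open>exp (- z) D (exp z) = D z + [D z, z] / 2! + [[D z, z], z] / 3! + \<dots>\<close>:
  the part \<open>V m\<close> of the left-hand side of degree \<open>m\<close> in \<open>z\<close> satisfies \<open>(m + 1) V (m + 1) = [V m, z]\<close>.\<close>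

lemma texp_derivation_mem:
  assumes D_add: "\<And>x y. D (x + y) = D x + D y"
    and D_mult: "\<And>x y. D (x * y) = x * D y + D x * y"
    and D_mem: "\<And>x k. x \<in> F k \<Longrightarrow> D x \<in> F k"
    and z: "z \<in> F (Suc 0)" and "D z \<in> S" "plus_subgroup S" "plus_subgroup T"
    and comm_S: "\<And>w. w \<in> S \<Longrightarrow> w * z - z * w \<in> S"
    and comm_T: "\<And>w. w \<in> S \<Longrightarrow> w * z - z * w \<in> T"
  shows "EXP (- z) * D (EXP z) - D z \<in> T"
proof -
  interpret S: plus_subgroup S by fact
  interpret T: plus_subgroup T by fact
  have D_0 [simp]: "D 0 = 0" using D_add[of 0 0] by simp
  have D_1 [simp]: "D 1 = 0" using D_mult[of 1 1] by simp
  have D_of_nat: "D (of_nat c * x) = of_nat c * D x" for c x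
    by (induction c) (auto simp: distrib_right D_add)
  have D_sum: "D (sum f I) = (\<Sum>i\<in>I. D (f i))" for f :: "nat \<Rightarrow> 'r" and I
    by (induction I rule: infinite_finite_induct) (auto simp: D_add)
  have mz: "- z \<in> F (Suc 0)" using z F_uminus by blast
  define V where "V m = (\<Sum>i\<le>m. E (- z) i * D (E z (m - i)))" for m
  have V_0: "V 0 = 0" by (simp add: V_def)
  have V_mem: "V m \<in> F m" for m
    unfolding V_def
    by (intro F_sum) (metis F_mult[OF dpow_mem[OF mz] D_mem[OF dpow_mem[OF z]]] atMost_iff le_add_diff_inverse)
  have V_Suc: "of_nat (Suc m) * V (Suc m) = V m * z - z * V m + (if m = 0 then D z else 0)" for m
  proof -
    have "of_nat (Suc m) * V (Suc m)
       = (\<Sum>i\<le>Suc m. of_nat i * (E (- z) i * D (E z (Suc m - i))))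
         + (\<Sum>i\<le>Suc m. of_nat (Suc m - i) * (E (- z) i * D (E z (Suc m - i))))"
      unfolding V_def sum_distrib_left sum.distrib[symmetric]
      by (intro sum.cong) (auto simp: distrib_right[symmetric] of_nat_add[symmetric] simp del: of_nat_add)
    also have "(\<Sum>i\<le>Suc m. of_nat i * (E (- z) i * D (E z (Suc m - i))))
        = (\<Sum>i\<le>m. (of_nat (Suc i) * E (- z) (Suc i)) * D (E z (m - i)))"
      by (simp only: sum.atMost_Suc_shift) (simp add: mult.assoc)
    also have "\<dots> = - (z * V m)"
      unfolding V_def dpow_Suc[OF mz] by (simp add: sum_distrib_left mult.assoc sum_negf)
    also have "(\<Sum>i\<le>Suc m. of_nat (Suc m - i) * (E (- z) i * D (E z (Suc m - i))))
        = (\<Sum>i\<le>m. E (- z) i * D (of_nat (Suc (m - i)) * E z (Suc (m - i))))"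
      unfolding D_of_nat by (simp add: Suc_diff_le of_nat_left_commute del: of_nat_Suc of_nat_diff)
    also have "\<dots> = (\<Sum>i\<le>m. E (- z) i * (E z (m - i) * D z + D (E z (m - i)) * z))"
      unfolding dpow_Suc'[OF z] D_mult ..
    also have "\<dots> = (\<Sum>i\<le>m. E (- z) i * E z (m - i)) * D z + V m * z"
      by (simp add: V_def sum_distrib_right distrib_left sum.distrib mult.assoc)
    \<comment> \<open>This is the part of degree m of exp (- z) exp z = 1.\<close>
    also have "(\<Sum>i\<le>m. E (- z) i * E z (m - i)) = (if m = 0 then 1 else 0)"
      using dpow_add[OF mz z, of m] by (simp add: dpow_def power_0_left)
    finally show ?thesis by (simp add: algebra_simps)
  qed
  have V_1: "V 1 = D z" using V_Suc[of 0] V_0 by simp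
  have V_S: "V (Suc m) \<in> S" for m
  proof (induction m)
    case 0
    then show ?case using assms V_1 by simp
  next
    case (Suc m)
    have eq: "of_nat (Suc (Suc m)) * V (Suc (Suc m)) = V (Suc m) * z - z * V (Suc m)"
      using V_Suc[of "Suc m"] by simp
    show ?case
    proof (cases "Suc (Suc m) \<le> n")
      case True
      then show ?thesis
        using of_nat_mult_mem_iff[OF S.plus_subgroup_axioms _ coprime_small, of "V (Suc (Suc m))" "Suc (Suc m)"]
          eq comm_S[OF Suc] F_antimono[OF V_mem] n_less_p by simp
    next
      case False
      then show ?thesis using F_zeroD[OF V_mem] S.zero_mem by simp
    qed
  qed
  have V_T: "V (Suc (Suc m)) \<in> T" for m
  proof (cases "Suc (Suc m) \<le> n")
    case True
    have eq: "of_nat (Suc (Suc m)) * V (Suc (Suc m)) = V (Suc m) * z - z * V (Suc m)"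
      using V_Suc[of "Suc m"] by simp
    show ?thesis
      using of_nat_mult_mem_iff[OF T.plus_subgroup_axioms _ coprime_small, of "V (Suc (Suc m))" "Suc (Suc m)"]
        eq comm_T[OF V_S] F_antimono[OF V_mem] n_less_p True by simp
  next
    case False
    then show ?thesis using F_zeroD[OF V_mem] T.zero_mem by simp
  qed
  have "EXP (- z) * D (EXP z) = (\<Sum>i\<le>n. E (- z) i) * (\<Sum>i\<le>n. D (E z i))"
    unfolding texp_def D_sum ..
  also have "\<dots> = (\<Sum>m\<le>n. V m)"
    unfolding V_def by (intro filtered_Cauchy_product dpow_mem D_mem z mz)
  finally have *: "EXP (- z) * D (EXP z) = (\<Sum>m\<le>n. V m)" .
  show ?thesis
  proof (cases n)
    case 0
    then have "z = 0" using z F_top by simp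
    then show ?thesis by (simp add: T.zero_mem)
  next
    case (Suc m)
    have "(\<Sum>m\<le>n. V m) = V 0 + (V 1 + (\<Sum>k<m. V (Suc (Suc k))))"
      unfolding Suc by (simp only: sum.atMost_shift lessThan_Suc_atMost) (simp add: sum.lessThan_Suc_shift flip: Suc)
    moreover have "(\<Sum>k<m. V (Suc (Suc k))) \<in> T" by (intro T.sum_mem V_T)
    ultimately show ?thesis by (simp add: * V_0 V_1[simplified])
  qed
qed

text \<open>The derivation formula for the inner derivation w -> x w - w x, which turns conjugation
  into iterated brackets with z.\<close>

lemma texp_conj_mem:
  assumes "x \<in> F 0" "z \<in> F (Suc 0)" "plus_subgroup S" "x * z - z * x \<in> S"
    and comm: "\<And>w. w \<in> S \<Longrightarrow> w * z - z * w \<in> S"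
  shows "EXP (- z) * x * EXP z - x \<in> S"
proof -
  interpret S: plus_subgroup S by fact
  have "EXP (- z) * (x * EXP z - EXP z * x) - (x * z - z * x) \<in> S"
  proof (rule texp_derivation_mem[where D = "\<lambda>w. x * w - w * x" and S = S])
    show "x * w - w * x \<in> F k" if "w \<in> F k" for w k
      using that assms(1) by (intro F_diff F_mult_left F_mult_right)
  qed (use assms in \<open>auto simp: algebra_simps\<close>)
  then have "EXP (- z) * (x * EXP z - EXP z * x) \<in> S"
    using S.add_mem[OF _ assms(4)] by force
  also have "EXP (- z) * (x * EXP z - EXP z * x) = EXP (- z) * x * EXP z - x"
    using texp_minus(2)[OF assms(2)] by (simp add: right_diff_distrib mult.assoc[symmetric])
  finally show ?thesis .
qed

section \<open>The Campbell-Hausdorff series to lowest order\<close>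

lemma texp_mult_log_mem:
  assumes "x \<in> F (Suc 0)" "y \<in> F j" "0 < j" "z \<in> F (Suc 0)" "EXP z = EXP x * EXP y"
  shows "z - (x + y) \<in> F (Suc j)"
proof -
  have y: "y \<in> F (Suc 0)" using F_posD[OF assms(2,3)] .
  have xy: "x + y \<in> F (Suc 0)" using assms y F_add by blast
  have "EXP z - EXP (x + y) = (EXP x - 1) * (EXP y - 1) + (EXP y - 1 - y)
      - (EXP (x + y) - EXP x - (x + y - x))"
    using assms(5) by (simp add: algebra_simps)
  also have "\<dots> \<in> F (Suc j)"
  proof (rule F_diff[OF F_add])
    show "(EXP x - 1) * (EXP y - 1) \<in> F (Suc j)"
      using F_mult[OF texp_minus_one_mem[OF assms(1)] texp_expand(2)[OF assms(2,3)]] by simp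
    show "EXP y - 1 - y \<in> F (Suc j)"
      using F_antimono[OF texp_expand(1)[OF assms(2,3)]] assms(3) by simp
    show "EXP (x + y) - EXP x - (x + y - x) \<in> F (Suc j)"
      using assms xy by (intro texp_diff_mem) auto
  qed
  finally show ?thesis using texp_diff_mem_iff[OF assms(4) xy] by blast
qed

text \<open>In the straightening of paths x and y themselves have low degree and only agree below
  degree j, so that \<open>texp_mult_log_mem\<close> would give too little.\<close>

lemma texp_quotient_log_mem:
  assumes "x \<in> F (Suc 0)" "y \<in> F (Suc 0)" "x - y \<in> F j" "0 < j" "z \<in> F (Suc 0)" "EXP z = EXP x * EXP (- y)"
  shows "z - (x - y) \<in> F (Suc j)"
proof -
  have xy: "x - y \<in> F (Suc 0)" using assms F_diff by blast
  have my: "- y \<in> F (Suc 0)" using assms F_uminus by blast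
  have "EXP z - EXP (x - y) = (EXP x - EXP y - (x - y)) * EXP (- y)
      + (x - y) * (EXP (- y) - 1) - (EXP (x - y) - 1 - (x - y))"
    using assms(6) texp_minus(1)[OF assms(2)] by (simp add: algebra_simps)
  also have "\<dots> \<in> F (Suc j)"
  proof (rule F_diff[OF F_add])
    show "(EXP x - EXP y - (x - y)) * EXP (- y) \<in> F (Suc j)"
      using assms my by (intro F_mult_right texp_diff_mem texp_mem)
    show "(x - y) * (EXP (- y) - 1) \<in> F (Suc j)"
      using F_mult[OF assms(3) texp_minus_one_mem[OF my]] by simp
    show "EXP (x - y) - 1 - (x - y) \<in> F (Suc j)"
      using F_antimono[OF texp_expand(1)[OF assms(3,4)]] assms(4) by simp
  qed
  finally show ?thesis using texp_diff_mem_iff[OF assms(5) xy] by blast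
qed

lemma texp_commutator_log_mem:
  assumes "x \<in> F (Suc 0)" "y \<in> F (Suc 0)" "z \<in> F (Suc 0)" "EXP z = EXP x * EXP y * EXP (- x) * EXP (- y)"
  shows "z - (x * y - y * x) \<in> F 3"
proof -
  define u v where "u = EXP x - 1 - x" and "v = EXP y - 1 - y"
  have u: "u \<in> F 2" and v: "v \<in> F 2"
    unfolding u_def v_def using texp_expand(1)[of _ 1] assms by auto
  have m: "- x \<in> F (Suc 0)" "- y \<in> F (Suc 0)" using assms F_uminus by blast+
  have e: "EXP x = 1 + x + u" "EXP y = 1 + y + v" by (simp_all add: u_def v_def)
  have xy: "x * y - y * x \<in> F 2"
    using F_mult[OF assms(1,2)] F_mult[OF assms(2,1)] F_diff by (simp add: numeral_2_eq_2)
  then have xy1: "x * y - y * x \<in> F (Suc 0)" by (rule F_posD) simp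
  \<comment> \<open>With g = exp x and h = exp y one has g h g^-1 h^-1 - 1 = (g h - h g) g^-1 h^-1,
    so it is g h - h g that is compared with x y - y x.\<close>
  define c where "c = EXP x * EXP y - EXP y * EXP x"
  have "c - (x * y - y * x) = (x * v - v * x) + (u * y - y * u) + (u * v - v * u)"
    unfolding c_def e by (simp add: algebra_simps)
  also have "\<dots> \<in> F 3"
    by (intro F_add F_diff F_multI[OF assms(1) v] F_multI[OF v assms(1)] F_multI[OF u assms(2)]
        F_multI[OF assms(2) u] F_multI[OF u v] F_multI[OF v u]) auto
  finally have c3: "c - (x * y - y * x) \<in> F 3" .
  have "(c - (x * y - y * x)) + (x * y - y * x) \<in> F 2"
    using F_add[OF F_antimono[OF c3] xy] by simp
  then have c2: "c \<in> F 2" by simp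
  have g: "EXP (- x) * EXP (- y) - 1 \<in> F (Suc 0)"
  proof -
    obtain w where w: "w \<in> F (Suc 0)" "EXP w = EXP (- x) * EXP (- y)" using texp_mult_surj[OF m] by blast
    then show ?thesis using texp_minus_one_mem[OF w(1)] by simp
  qed
  have "EXP y * EXP x * (EXP (- x) * EXP (- y)) = EXP y * (EXP x * EXP (- x)) * EXP (- y)"
    by (simp add: mult.assoc)
  then have one: "EXP y * EXP x * (EXP (- x) * EXP (- y)) = 1"
    using texp_minus assms by simp
  have "EXP z - 1 = c * (EXP (- x) * EXP (- y))"
    unfolding c_def left_diff_distrib one assms(4) by (simp add: mult.assoc)
  then have "EXP z - EXP (x * y - y * x) = c * (EXP (- x) * EXP (- y) - 1) + (c - (x * y - y * x))
      - (EXP (x * y - y * x) - 1 - (x * y - y * x))"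
    by (simp add: algebra_simps)
  also have "\<dots> \<in> F 3"
    using F_multI[OF c2 g, of 3] F_antimono[OF texp_expand(1)[OF xy], of 3] c3 by (intro F_diff[OF F_add]) auto
  finally show ?thesis using texp_diff_mem_iff[OF assms(3) xy1] by blast
qed

end

section \<open>Polynomial paths\<close>

unbundle fps_syntax

text \<open>The operator t d/dt is preferred to d/dt because it preserves the degree, hence every
  step of the filtration \<open>W\<close>.\<close>

definition fps_euler :: "'r::ring_1 fps \<Rightarrow> 'r fps" where
  "fps_euler f = Abs_fps (\<lambda>i. of_nat i * f $ i)"

definition fps_monom :: "nat \<Rightarrow> 'r::ring_1 \<Rightarrow> 'r fps" where
  "fps_monom k d = Abs_fps (\<lambda>i. if i = k then d else 0)"

text \<open>Evaluation at t = s. If coefficient i lies in \<open>F i\<close>, the truncation at n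
  loses nothing, and evaluation is multiplicative.\<close>

definition fps_eval :: "nat \<Rightarrow> nat \<Rightarrow> 'r::ring_1 fps \<Rightarrow> 'r" where
  "fps_eval n s f = (\<Sum>i\<le>n. of_nat (s ^ i) * f $ i)"

lemma fps_euler_nth [simp]: "fps_euler f $ i = of_nat i * f $ i"
  by (simp add: fps_euler_def)

lemma fps_monom_nth [simp]: "fps_monom k d $ i = (if i = k then d else 0)"
  by (simp add: fps_monom_def)

lemma fps_monom_mult: "fps_monom i x * fps_monom j y = fps_monom (i + j) (x * y)"
proof (rule fps_ext)
  fix k
  have "(fps_monom i x * fps_monom j y) $ k
      = (\<Sum>l\<in>{0..k}. if l = i then (if k - i = j then x * y else 0) else 0)"
    unfolding fps_mult_nth by (rule sum.cong) auto
  also have "\<dots> = fps_monom (i + j) (x * y) $ k" by auto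
  finally show "(fps_monom i x * fps_monom j y) $ k = fps_monom (i + j) (x * y) $ k" .
qed

lemma fps_euler_add: "fps_euler (f + g) = fps_euler f + fps_euler g"
  by (simp add: fps_eq_iff distrib_left)

lemma fps_euler_mult: "fps_euler (f * g) = f * fps_euler g + fps_euler f * g"
proof (rule fps_ext)
  fix k
  have "fps_euler (f * g) $ k = (\<Sum>i=0..k. of_nat k * (f $ i * g $ (k - i)))"
    by (simp add: fps_mult_nth sum_distrib_left)
  also have "\<dots> = (\<Sum>i=0..k. f $ i * (of_nat (k - i) * g $ (k - i)) + of_nat i * f $ i * g $ (k - i))"
  proof (rule sum.cong)
    fix i assume "i \<in> {0..k}"
    then have "of_nat k = of_nat (k - i) + (of_nat i :: 'a)" by (simp flip: of_nat_add)
    then show "of_nat k * (f $ i * g $ (k - i)) = f $ i * (of_nat (k - i) * g $ (k - i)) + of_nat i * f $ i * g $ (k - i)"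
      by (simp only: distrib_right of_nat_left_commute mult.assoc)
  qed simp
  also have "\<dots> = (f * fps_euler g + fps_euler f * g) $ k"
    by (simp add: fps_mult_nth sum.distrib)
  finally show "fps_euler (f * g) $ k = (f * fps_euler g + fps_euler f * g) $ k" .
qed

lemma fps_commutator_nth:
  "(f * g - g * f) $ k = (\<Sum>i=0..k. f $ i * g $ (k - i) - g $ (k - i) * (f $ i :: 'r::ring_1))"
proof -
  have "(g * f) $ k = (\<Sum>i=0..k. g $ (k - i) * f $ i)"
    unfolding fps_mult_nth by (rule sum.reindex_bij_witness[of _ "\<lambda>i. k - i" "\<lambda>i. k - i"]) auto
  then show ?thesis by (simp add: fps_mult_nth sum_subtractf)
qed

lemma fps_eval_add: "fps_eval m s (f + g) = fps_eval m s f + fps_eval m s g"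
  by (simp add: fps_eval_def distrib_left sum.distrib)

lemma fps_eval_0 [simp]: "fps_eval m s 0 = 0"
  by (simp add: fps_eval_def)

lemma fps_eval_1 [simp]: "fps_eval m s 1 = 1"
proof -
  have "fps_eval m s 1 = (\<Sum>i\<le>m. if i = 0 then 1 else 0)"
    unfolding fps_eval_def by (rule sum.cong) auto
  then show ?thesis by simp
qed

lemma fps_eval_uminus: "fps_eval m s (- f) = - fps_eval m s f"
  by (simp add: fps_eval_def sum_negf)

lemma fps_eval_of_nat_mult: "fps_eval m s (of_nat c * f) = of_nat c * fps_eval m s f"
  by (simp add: fps_eval_def sum_distrib_left of_nat_left_commute)

lemma fps_eval_sum: "fps_eval m s (sum f I) = (\<Sum>i\<in>I. fps_eval m s (f i))"
  by (induction I rule: infinite_finite_induct) (auto simp: fps_eval_add)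

section \<open>The filtered ring of paths\<close>

context filtered_ring
begin

text \<open>A Rees-type ring: the condition on coefficient i makes series of order above n vanish,
  so that the order in t is a filtration of the same length as \<open>F\<close>.\<close>

definition W :: "nat \<Rightarrow> 'r fps set" where
  "W k = {f. \<forall>i. f $ i \<in> F i \<and> (i < k \<longrightarrow> f $ i = 0)}"

lemma WD: "f \<in> W k \<Longrightarrow> f $ i \<in> F i" "f \<in> W k \<Longrightarrow> i < k \<Longrightarrow> f $ i = 0"
  by (auto simp: W_def)

lemma filtered_ring_W: "filtered_ring W p n"
proof
  show "Factorial_Ring.prime p" "2 ^ n < p" by (fact prime_p n_small)+
  show "0 \<in> W k" for k by (simp add: W_def F_zero)
  show "x + y \<in> W k" if "x \<in> W k" "y \<in> W k" for k x y
    using that by (auto simp: W_def intro: F_add)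
  show "- x \<in> W k" if "x \<in> W k" for k x
    using that by (auto simp: W_def intro: F_uminus)
  show "W (Suc k) \<subseteq> W k" for k by (auto simp: W_def)
  show "1 \<in> W 0" by (auto simp: W_def F_zero F_one)
  show "x * y \<in> W (i + j)" if "x \<in> W i" "y \<in> W j" for x y i j
  proof -
    have "(x * y) $ k \<in> F k" for k
      unfolding fps_mult_nth
      by (intro F_sum) (metis F_mult WD(1) that atLeastAtMost_iff le_add_diff_inverse)
    moreover have "(x * y) $ k = 0" if "k < i + j" for k
      unfolding fps_mult_nth
    proof (rule sum.neutral, rule ballI)
      fix l assume "l \<in> {0..k}"
      then have "l < i \<or> k - l < j" using that by auto
      then show "x $ l * y $ (k - l) = 0" using WD(2) \<open>x \<in> W i\<close> \<open>y \<in> W j\<close> by auto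
    qed
    ultimately show ?thesis by (simp add: W_def)
  qed
  show "x = 0" if "x \<in> W (Suc n)" for x
  proof (rule fps_ext)
    show "x $ i = 0 $ i" for i
      using WD[OF that, of i] F_zeroD by (cases "i < Suc n") auto
  qed
  show "of_nat (p ^ n) * x = 0" if "x \<in> W (Suc 0)" for x
  proof (rule fps_ext)
    show "(of_nat (p ^ n) * x) $ i = 0 $ i" for i
      using WD[OF that, of i] F_torsion[OF F_posD] by (cases "i = 0") (auto simp del: of_nat_power)
  qed
qed

lemma fps_monom_mem: "d \<in> F k \<Longrightarrow> fps_monom k d \<in> W k"
  by (auto simp: W_def F_zero)

lemma fps_eval_monom: "d \<in> F k \<Longrightarrow> fps_eval n s (fps_monom k d) = of_nat (s ^ k) * d"
proof -
  assume d: "d \<in> F k"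
  have "fps_eval n s (fps_monom k d) = (\<Sum>i\<le>n. if i = k then of_nat (s ^ k) * d else 0)"
    unfolding fps_eval_def by (rule sum.cong) auto
  then show ?thesis using F_zeroD[OF d] by (auto simp: not_le)
qed

lemma fps_eval_mem: "f \<in> W k \<Longrightarrow> fps_eval n s f \<in> F k"
  unfolding fps_eval_def
proof (intro F_sum)
  fix i assume "f \<in> W k"
  then show "of_nat (s ^ i) * f $ i \<in> F k"
    using WD[of f k i] F_antimono[of "f $ i" i k] F_zero F_of_nat_mult by (cases "i < k") (auto simp del: of_nat_power)
qed

lemma fps_eval_mult:
  assumes "f \<in> W 0" "g \<in> W 0" shows "fps_eval n s (f * g) = fps_eval n s f * fps_eval n s g"
proof -
  have "fps_eval n s f * fps_eval n s g
      = (\<Sum>k\<le>n. \<Sum>i\<le>k. (of_nat (s ^ i) * f $ i) * (of_nat (s ^ (k - i)) * g $ (k - i)))"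
    unfolding fps_eval_def
    by (rule filtered_Cauchy_product; intro F_of_nat_mult WD(1)[OF assms(1)] WD(1)[OF assms(2)])
  also have "\<dots> = fps_eval n s (f * g)"
    unfolding fps_eval_def fps_mult_nth atLeast0AtMost sum_distrib_left
  proof (intro sum.cong refl)
    fix k i :: nat assume "i \<in> {..k}"
    then have "s ^ k = s ^ i * s ^ (k - i)" by (simp flip: power_add)
    then show "(of_nat (s ^ i) * f $ i) * (of_nat (s ^ (k - i)) * g $ (k - i))
        = of_nat (s ^ k) * (f $ i * g $ (k - i))"
      by (simp only: of_nat_mult_mult)
  qed
  finally show ?thesis ..
qed

context
begin

interpretation W: filtered_ring W p n by (rule filtered_ring_W)

lemma fps_eval_texp:
  assumes "z \<in> W (Suc 0)" shows "fps_eval n s (EXP z) = EXP (fps_eval n s z)"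
proof -
  have "fps_eval n s (z ^ k) = fps_eval n s z ^ k" for k
    by (induction k) (auto simp: fps_eval_mult W.F_0I[OF assms] W.F_0I[OF W.F_power[OF assms]])
  then show ?thesis by (simp add: texp_def dpow_def fps_eval_sum fps_eval_of_nat_mult)
qed

lemma texp_multiple_mem:
  assumes "1 \<in> G" "\<And>g h. g \<in> G \<Longrightarrow> h \<in> G \<Longrightarrow> g * h \<in> G" "x \<in> F (Suc 0)" "EXP x \<in> G"
  shows "EXP (of_nat c * x) \<in> G" "EXP (- x) \<in> G"
proof -
  show *: "EXP (of_nat c * x) \<in> G" for c
    unfolding texp_of_nat_mult[OF assms(3)] by (induction c) (auto simp: assms)
  \<comment> \<open>Since M x = 0, the element - x is the multiple (M - 1) x, and the inverse of
    \<open>EXP x\<close> is one of its powers.\<close>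
  have "0 < M" using prime_p by (simp add: prime_gt_0_nat)
  then have "of_nat (M - 1) * x + x = of_nat M * x"
    by (metis (no_types) Suc_diff_1 add.commute distrib_right mult_1 of_nat_Suc)
  then have "of_nat (M - 1) * x = - x" using F_torsion[OF assms(3)] by (simp add: eq_neg_iff_add_eq_0)
  then show "EXP (- x) \<in> G" using *[of "M - 1"] by simp
qed

lemma texp_root_mem:
  assumes "1 \<in> G" "\<And>g h. g \<in> G \<Longrightarrow> h \<in> G \<Longrightarrow> g * h \<in> G" "x \<in> F (Suc 0)" "EXP (of_nat k * x) \<in> G" "coprime k p"
  shows "EXP x \<in> G"
  using texp_multiple_mem(1)[OF assms(1,2) F_of_nat_mult[OF assms(3)] assms(4), of "rcp M k"]
    rcp_of_nat_mult(1)[OF assms(3,5)] by simp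

text \<open>A path \<open>s \<mapsto> exp (s\<^sup>k d + s\<^sup>j b + \<dots>)\<close> in \<open>G\<close> is straightened from the
  bottom up: dividing its reparametrisation at \<open>2 s\<close> by its \<open>2\<^sup>k\<close>-th power removes the term
  \<open>s\<^sup>k d\<close> and leaves a path in \<open>G\<close> starting with \<open>(2\<^sup>j - 2\<^sup>k) s\<^sup>j b\<close>, so that
  \<open>exp b \<in> G\<close> by induction and the term \<open>s\<^sup>j b\<close> can be removed from the path.\<close>

lemma texp_path_leading_mem:
  assumes G: "1 \<in> G" "\<And>g h. g \<in> G \<Longrightarrow> h \<in> G \<Longrightarrow> g * h \<in> G"
    and "z \<in> W (Suc 0)" "d \<in> F k" "0 < k" "k < j" "z - fps_monom k d \<in> W j"
    and "\<And>s. EXP (fps_eval n s z) \<in> G"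
  shows "EXP d \<in> G"
  using assms(3-)
\<comment> \<open>The induction hypothesis is used for the pairs (j, j + 1) and (k, j + 1). Both
  have a larger sum than (k, j), and j \<le> n keeps the measure positive.\<close>
proof (induction "2 * Suc n - (k + j)" arbitrary: z d k j rule: less_induct)
  case less
  note z = less.prems(1) and d = less.prems(2)
  have ez: "fps_eval n s z \<in> F (Suc 0)" for s using fps_eval_mem[OF z] .
  show ?case
  proof (cases "j \<le> n")
    case False
    then have "z = fps_monom k d" using W.F_zeroD[OF less.prems(5)] by simp
    then show ?thesis using less.prems(6)[of 1] fps_eval_monom[OF d] by simp
  next
    case True
    define b where "b = z $ j"
    have b: "b \<in> F j" using WD(1)[OF z] by (simp add: b_def)
    have b1: "b \<in> F (Suc 0)" using F_posD[OF b] less.prems by simp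
    have z_low: "z $ i = (if i = k then d else 0)" if "i < j" for i
      using WD(2)[OF less.prems(5) that] by auto
    define x where "x = Abs_fps (\<lambda>i. of_nat (2 ^ i) * z $ i)"
    define y where "y = of_nat (2 ^ k) * z"
    define c where "c = (2 ^ j - 2 ^ k :: nat)"
    have c_coprime: "coprime c p"
    proof -
      have p2: "2 < p" using True less.prems n_small
        by (metis (no_types) dual_order.strict_trans1 le_trans less_one linorder_not_less nat_neq_iff not_less_zero power_increasing power_one_right one_le_numeral)
      \<comment> \<open>The second factor is positive and smaller than 2^n, hence prime to p by the
        bound 2^n < p.\<close>
      have "c = 2 ^ k * (2 ^ (j - k) - 1)"
        using less.prems(4) by (simp add: c_def diff_mult_distrib2 flip: power_add)
      moreover have "coprime (2 ^ k) p" using coprime_small[of 2] p2 by simp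
      moreover have "coprime (2 ^ (j - k) - 1) p"
      proof (rule coprime_small)
        show "0 < (2 ^ (j - k) - 1 :: nat)" using less.prems(4) one_less_power[of "2::nat" "j - k"] by simp
        have "(2::nat) ^ (j - k) \<le> 2 ^ n" using True by (intro power_increasing) auto
        then show "2 ^ (j - k) - 1 < p" using n_small by linarith
      qed
      ultimately show ?thesis by simp
    qed
    have x: "x \<in> W (Suc 0)"
      using z by (auto simp: W_def x_def intro: F_of_nat_mult simp del: of_nat_power)
    have y: "y \<in> W (Suc 0)" unfolding y_def by (rule W.F_of_nat_mult[OF z])
    have my: "- y \<in> W (Suc 0)" using W.F_uminus[OF y] .
    have xy1: "x - y \<in> W (Suc 0)" using W.F_diff[OF x y] .
    have cb: "of_nat c * b = of_nat (2 ^ j) * b - of_nat (2 ^ k) * b"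
      using less.prems(4) by (simp add: c_def of_nat_diff left_diff_distrib power_increasing)
    have xy: "x - y - fps_monom j (of_nat c * b) \<in> W (Suc j)"
    proof -
      have "(x - y - fps_monom j (of_nat c * b)) $ i = 0" if "i < Suc j" for i
        using that z_low[of i] cb by (cases "i = j") (auto simp: x_def y_def b_def simp del: of_nat_power)
      moreover have "x - y - fps_monom j (of_nat c * b) \<in> W 0"
        by (intro W.F_diff W.F_0I[OF x] W.F_0I[OF y] W.F_0I[OF fps_monom_mem] F_of_nat_mult b)
      ultimately show ?thesis by (auto simp: W_def)
    qed
    have xyj: "x - y \<in> W j"
    proof -
      have "x - y - fps_monom j (of_nat c * b) \<in> W j" using xy by (rule W.F_antimono) simp
      from W.F_add[OF this fps_monom_mem[OF F_of_nat_mult[OF b, of c]]] show ?thesis by simp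
    qed
    obtain z2 where z2: "z2 \<in> W (Suc 0)" "EXP z2 = EXP x * EXP (- y)"
      using W.texp_mult_surj[OF x my] by blast
    have "z2 - (x - y) \<in> W (Suc j)"
      using W.texp_quotient_log_mem[OF x y xyj _ z2] less.prems by simp
    from W.F_add[OF this xy] have z2_lead: "z2 - fps_monom j (of_nat c * b) \<in> W (Suc j)" by simp
    have z2_path: "EXP (fps_eval n s z2) \<in> G" for s
    proof -
      have "fps_eval n s x = fps_eval n (2 * s) z"
        unfolding fps_eval_def x_def fps_nth_Abs_fps
        by (simp only: power_mult_distrib mult.commute[of "2 ^ _"] of_nat_mult mult.assoc)
      then have "EXP (fps_eval n s x) \<in> G" using less.prems by simp
      moreover have "EXP (fps_eval n s y) \<in> G"
        unfolding y_def fps_eval_of_nat_mult using texp_multiple_mem(1)[OF G ez less.prems(6)] .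
      then have "EXP (fps_eval n s (- y)) \<in> G"
        unfolding fps_eval_uminus using texp_multiple_mem(2)[OF G fps_eval_mem[OF y]] by blast
      moreover have "EXP (fps_eval n s z2) = EXP (fps_eval n s x) * EXP (fps_eval n s (- y))"
        unfolding fps_eval_texp[OF z2(1), symmetric] z2(2)
        by (simp add: fps_eval_mult W.texp_mem x my fps_eval_texp)
      ultimately show ?thesis using G by simp
    qed
    have Gcb: "EXP (of_nat c * b) \<in> G"
    proof (rule less.hyps[OF _ z2(1) F_of_nat_mult[OF b] _ _ z2_lead z2_path])
      show "2 * Suc n - (j + Suc j) < 2 * Suc n - (k + j)" using less.prems True by simp
    qed (use less.prems in auto)
    have Gb: "EXP b \<in> G" using texp_root_mem[OF G b1 Gcb c_coprime] by blast
    define m where "m = fps_monom j (- b)"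
    have m: "m \<in> W j" unfolding m_def by (intro fps_monom_mem F_uminus b)
    have m1: "m \<in> W (Suc 0)" using W.F_posD[OF m] less.prems by simp
    obtain z' where z': "z' \<in> W (Suc 0)" "EXP z' = EXP z * EXP m"
      using W.texp_mult_surj[OF z m1] by blast
    have "z' - (z + m) \<in> W (Suc j)"
      using W.texp_mult_log_mem[OF z m _ z'] less.prems by simp
    moreover have "z + m - fps_monom k d \<in> W (Suc j)"
    proof -
      have "(z + m - fps_monom k d) $ i = 0" if "i < Suc j" for i
        using that z_low[of i] less.prems by (cases "i = j") (auto simp: m_def b_def)
      moreover have "z + m - fps_monom k d \<in> W 0"
        by (intro W.F_diff W.F_add W.F_0I[OF z] W.F_0I[OF m] W.F_0I[OF fps_monom_mem] d)
      ultimately show ?thesis by (auto simp: W_def)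
    qed
    ultimately have z'_lead: "z' - fps_monom k d \<in> W (Suc j)"
      using W.F_add by fastforce
    have z'_path: "EXP (fps_eval n s z') \<in> G" for s
    proof -
      have "EXP (fps_eval n s m) \<in> G"
        unfolding m_def fps_eval_monom[OF F_uminus[OF b]] mult_minus_right
        by (intro texp_multiple_mem G F_of_nat_mult b1 Gb)
      moreover have "EXP (fps_eval n s z') = EXP (fps_eval n s z) * EXP (fps_eval n s m)"
        unfolding fps_eval_texp[OF z'(1), symmetric] z'(2)
        by (simp add: fps_eval_mult W.texp_mem z m1 fps_eval_texp)
      ultimately show ?thesis using G less.prems(6) by simp
    qed
    show ?thesis
    proof (rule less.hyps[OF _ z'(1) d _ _ z'_lead z'_path])
      show "2 * Suc n - (k + Suc j) < 2 * Suc n - (k + j)" using less.prems True by simp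
    qed (use less.prems in auto)
  qed
qed

lemma texp_sum_mem:
  assumes G: "1 \<in> G" "\<And>g h. g \<in> G \<Longrightarrow> h \<in> G \<Longrightarrow> g * h \<in> G"
    and x: "x \<in> F (Suc 0)" "EXP x \<in> G" and y: "y \<in> F (Suc 0)" "EXP y \<in> G"
  shows "EXP (x + y) \<in> G"
proof -
  let ?x = "fps_monom (Suc 0) x" and ?y = "fps_monom (Suc 0) y"
  have m: "?x \<in> W (Suc 0)" "?y \<in> W (Suc 0)" using x y fps_monom_mem by blast+
  obtain z where z: "z \<in> W (Suc 0)" "EXP z = EXP ?x * EXP ?y"
    using W.texp_mult_surj[OF m] by blast
  have "?x + ?y = fps_monom (Suc 0) (x + y)" by (simp add: fps_eq_iff)
  then have lead: "z - fps_monom (Suc 0) (x + y) \<in> W (Suc (Suc 0))"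
    using W.texp_mult_log_mem[OF m _ z] by simp
  have path: "EXP (fps_eval n s z) \<in> G" for s
  proof -
    have "EXP (fps_eval n s z) = EXP (of_nat s * x) * EXP (of_nat s * y)"
      unfolding fps_eval_texp[OF z(1), symmetric] z(2)
      by (simp add: fps_eval_mult W.texp_mem m fps_eval_texp fps_eval_monom x y)
    then show ?thesis using G texp_multiple_mem(1)[OF G] x y by simp
  qed
  show ?thesis by (rule texp_path_leading_mem[OF G z(1) F_add[OF x(1) y(1)] _ _ lead path]) auto
qed

text \<open>Only the commutators are asked to lie in G, not \<open>EXP x\<close> and
  \<open>EXP y\<close>. Thus G can be the whole group of a brace, but also the exponentials of p L
  in a powerful group.\<close>

lemma texp_commutator_mem:
  assumes G: "1 \<in> G" "\<And>g h. g \<in> G \<Longrightarrow> h \<in> G \<Longrightarrow> g * h \<in> G"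
    and x: "x \<in> F (Suc 0)" and y: "y \<in> F (Suc 0)"
    and comm: "\<And>s. EXP (of_nat s * x) * EXP (of_nat s * y) * EXP (- (of_nat s * x)) * EXP (- (of_nat s * y)) \<in> G"
  shows "EXP (x * y - y * x) \<in> G"
proof -
  let ?x = "fps_monom (Suc 0) x" and ?y = "fps_monom (Suc 0) y"
  have m: "?x \<in> W (Suc 0)" "?y \<in> W (Suc 0)" "- ?x \<in> W (Suc 0)" "- ?y \<in> W (Suc 0)"
    using x y fps_monom_mem W.F_uminus by blast+
  obtain z1 where z1: "z1 \<in> W (Suc 0)" "EXP z1 = EXP ?x * EXP ?y"
    using W.texp_mult_surj[OF m(1,2)] by blast
  obtain z2 where z2: "z2 \<in> W (Suc 0)" "EXP z2 = EXP z1 * EXP (- ?x)"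
    using W.texp_mult_surj[OF z1(1) m(3)] by blast
  obtain z where z: "z \<in> W (Suc 0)" "EXP z = EXP z2 * EXP (- ?y)"
    using W.texp_mult_surj[OF z2(1) m(4)] by blast
  have "?x * ?y - ?y * ?x = fps_monom 2 (x * y - y * x)"
    by (auto simp: fps_monom_mult fps_eq_iff numeral_2_eq_2)
  then have lead: "z - fps_monom 2 (x * y - y * x) \<in> W 3"
    using W.texp_commutator_log_mem[OF m(1,2) z(1)] by (simp add: z(2) z2(2) z1(2))
  have path: "EXP (fps_eval n s z) \<in> G" for s
  proof -
    have "EXP (fps_eval n s z1) = EXP (of_nat s * x) * EXP (of_nat s * y)"
      unfolding fps_eval_texp[OF z1(1), symmetric] z1(2)
      by (simp add: fps_eval_mult W.texp_mem m fps_eval_texp fps_eval_monom x y)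
    moreover have "EXP (fps_eval n s z2) = EXP (fps_eval n s z1) * EXP (- (of_nat s * x))"
      unfolding fps_eval_texp[OF z2(1), symmetric] z2(2)
      by (simp add: fps_eval_mult W.texp_mem m z1(1) fps_eval_texp fps_eval_uminus fps_eval_monom x)
    moreover have "EXP (fps_eval n s z) = EXP (fps_eval n s z2) * EXP (- (of_nat s * y))"
      unfolding fps_eval_texp[OF z(1), symmetric] z(2)
      by (simp add: fps_eval_mult W.texp_mem m z2(1) fps_eval_texp fps_eval_uminus fps_eval_monom y)
    ultimately have "EXP (fps_eval n s z) = EXP (of_nat s * x) * EXP (of_nat s * y) * EXP (- (of_nat s * x)) * EXP (- (of_nat s * y))"
      by simp
    then show ?thesis using comm by simp
  qed
  have xy: "x * y - y * x \<in> F 2"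
    using F_diff[OF F_mult[OF x y] F_mult[OF y x]] by (simp add: numeral_2_eq_2)
  show ?thesis by (rule texp_path_leading_mem[OF G z(1) xy _ _ lead path]) auto
qed

text \<open>Coefficient i of the logarithmic derivative is i times coefficient i of z plus brackets.
  As z has no constant term, these brackets involve only lower coefficients; hence S looks at
  degrees below i, and T also at degree i. Finally i is invertible for 0 < i \<le> n.\<close>

lemma texp_log_coeffs_mem:
  assumes "plus_subgroup L" and bracket: "\<And>x y. x \<in> L \<Longrightarrow> y \<in> L \<Longrightarrow> x * y - y * x \<in> L"
    and z: "z \<in> W (Suc 0)" and deriv: "\<And>i. (EXP (- z) * fps_euler (EXP z)) $ i \<in> L"
  shows "z $ i \<in> L"
proof (induction i rule: less_induct)
  case (less i)
  interpret L: plus_subgroup L by fact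
  have z0: "z $ 0 = 0" using WD(2)[OF z] by simp
  define S where "S = {f. f $ 0 = 0 \<and> (\<forall>j<i. f $ j \<in> L)}"
  define T where "T = {f. \<forall>j\<le>i. f $ j \<in> L}"
  have S: "plus_subgroup S" and T: "plus_subgroup T"
    by (unfold_locales; auto simp: S_def T_def L.zero_mem L.add_mem L.uminus_mem)+
  have comm: "(w * z - z * w) $ j \<in> L" if w: "w \<in> S" and j: "j \<le> i" for w j
    unfolding fps_commutator_nth
  proof (rule L.sum_mem)
    fix l assume l: "l \<in> {0..j}"
    consider "l = 0" | "j - l = 0" | "l < i" "j - l < i" using l j by fastforce
    then show "w $ l * z $ (j - l) - z $ (j - l) * w $ l \<in> L"
    proof cases
      case 3
      then show ?thesis using w less.IH bracket by (simp add: S_def)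
    qed (use w z0 L.zero_mem in \<open>auto simp: S_def\<close>)
  qed
  have "EXP (- z) * fps_euler (EXP z) - fps_euler z \<in> T"
  proof (rule W.texp_derivation_mem[OF fps_euler_add fps_euler_mult _ z _ S T])
    show "fps_euler f \<in> W k" if "f \<in> W k" for f k
      using that by (auto simp: W_def intro: F_of_nat_mult)
    show "fps_euler z \<in> S"
      using less.IH plus_subgroup_of_nat_mult[OF assms(1)] by (auto simp: S_def)
    show "w * z - z * w \<in> S" if "w \<in> S" for w
      using comm[OF that] that z0 by (simp add: S_def)
    show "w * z - z * w \<in> T" if "w \<in> S" for w
      using comm[OF that] by (simp add: T_def)
  qed
  then have "(EXP (- z) * fps_euler (EXP z)) $ i - of_nat i * z $ i \<in> L" by (simp add: T_def)
  from L.diff_mem[OF deriv[of i] this] have *: "of_nat i * z $ i \<in> L" by simp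
  show ?case
  proof (cases "i = 0 \<or> n < i")
    case True
    then show ?thesis using z0 F_zeroD[OF WD(1)[OF z]] L.zero_mem by auto
  next
    case False
    then show ?thesis
      using of_nat_mult_mem_iff[OF assms(1) F_posD[OF WD(1)[OF z]] coprime_small] * n_less_p by simp
  qed
qed

text \<open>The series t x is its own Euler derivative and commutes with itself, so all bracket
  terms of the derivation formula vanish.\<close>

lemma fps_euler_texp_monom:
  assumes "x \<in> F (Suc 0)"
  shows "fps_euler (EXP (fps_monom (Suc 0) x)) = EXP (fps_monom (Suc 0) x) * fps_monom (Suc 0) x"
proof -
  let ?x = "fps_monom (Suc 0) x"
  have x: "?x \<in> W (Suc 0)" by (rule fps_monom_mem[OF assms])
  have e: "fps_euler ?x = ?x" by (simp add: fps_eq_iff)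
  have "EXP (- ?x) * fps_euler (EXP ?x) - fps_euler ?x \<in> {0}"
  proof (rule W.texp_derivation_mem[OF fps_euler_add fps_euler_mult _ x, where S = "{w. w * ?x = ?x * w}"])
    show "fps_euler f \<in> W k" if "f \<in> W k" for f k
      using that by (auto simp: W_def intro: F_of_nat_mult)
  qed (unfold_locales, auto simp: e algebra_simps)
  then have "EXP ?x * (EXP (- ?x) * fps_euler (EXP ?x)) = EXP ?x * ?x" by (simp add: e)
  then show ?thesis using W.texp_minus(1)[OF x] by (simp flip: mult.assoc)
qed

text \<open>Along the path \<open>exp (s x) exp (- s y)\<close> the logarithmic derivative stays in \<open>L\<close>,
  hence so does the logarithm.\<close>

lemma texp_quotient_mem:
  assumes "plus_subgroup L" and bracket: "\<And>x y. x \<in> L \<Longrightarrow> y \<in> L \<Longrightarrow> x * y - y * x \<in> L"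
    and x: "x \<in> F (Suc 0)" and y: "y \<in> F (Suc 0)" and "x - y \<in> L"
    and normal: "\<And>w. w \<in> L \<Longrightarrow> w * y - y * w \<in> L"
  shows "\<exists>z\<in>L. z \<in> F (Suc 0) \<and> EXP z = EXP x * EXP (- y)"
proof -
  interpret L: plus_subgroup L by fact
  let ?x = "fps_monom (Suc 0) x" and ?y = "fps_monom (Suc 0) y"
  have mx: "?x \<in> W (Suc 0)" and my: "?y \<in> W (Suc 0)" and mmy: "- ?y \<in> W (Suc 0)"
    using x y fps_monom_mem W.F_uminus by blast+
  obtain z where z: "z \<in> W (Suc 0)" "EXP z = EXP ?x * EXP (- ?y)"
    using W.texp_mult_surj[OF mx mmy] by blast
  have inv: "EXP (- z) = EXP ?y * EXP (- ?x)"
  proof -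
    have "EXP z * (EXP ?y * EXP (- ?x)) = EXP ?x * (EXP (- ?y) * EXP ?y) * EXP (- ?x)"
      by (simp add: z mult.assoc)
    then have "EXP z * (EXP ?y * EXP (- ?x)) = 1"
      using W.texp_minus mx my by simp
    then have "EXP (- z) * EXP z * (EXP ?y * EXP (- ?x)) = EXP (- z)" by (simp add: mult.assoc)
    then show ?thesis using W.texp_minus(2)[OF z(1)] by simp
  qed
  have e: "fps_euler (EXP (- ?y)) = - (?y * EXP (- ?y))"
  proof -
    have "- ?y = fps_monom (Suc 0) (- y)" by (simp add: fps_eq_iff)
    then have "fps_euler (EXP (- ?y)) = EXP (- ?y) * (- ?y)"
      using fps_euler_texp_monom[OF F_uminus[OF y]] by simp
    also have "\<dots> = - (?y * EXP (- ?y))"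
      using texp_commute[of "- ?y" ?y M n] by simp
    finally show ?thesis .
  qed
  \<comment> \<open>The logarithmic derivative is t (x - y) conjugated by exp (t y). Therefore it is
    x - y that has to lie in L, with L stable under brackets with y; x and y themselves may lie
    outside, as happens later for L = \<open>pL\<close>.\<close>
  have "EXP (- z) * fps_euler (EXP z) = EXP ?y * (EXP (- ?x) * EXP ?x) * (?x - ?y) * EXP (- ?y)"
    unfolding z(2) fps_euler_mult e fps_euler_texp_monom[OF x] inv by (simp add: algebra_simps)
  then have eq: "EXP (- z) * fps_euler (EXP z) = EXP ?y * (?x - ?y) * EXP (- ?y)"
    using W.texp_minus(2)[OF mx] by simp
  define S where "S = {f. \<forall>i. f $ i \<in> L}"
  have "EXP (- (- ?y)) * (?x - ?y) * EXP (- ?y) - (?x - ?y) \<in> S"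
  proof (rule W.texp_conj_mem[OF _ mmy])
    show "?x - ?y \<in> W 0" using W.F_0I[OF W.F_diff[OF mx my]] .
    show "plus_subgroup S"
      by (unfold_locales) (auto simp: S_def L.zero_mem L.add_mem L.uminus_mem)
    show comm: "w * - ?y - - ?y * w \<in> S" if "w \<in> S" for w
    proof -
      have "(w * ?y - ?y * w) $ k \<in> L" for k
        unfolding fps_commutator_nth
        using that normal L.zero_mem by (intro L.sum_mem) (auto simp: S_def)
      from L.uminus_mem[OF this] show ?thesis by (simp add: S_def)
    qed
    show "(?x - ?y) * - ?y - - ?y * (?x - ?y) \<in> S"
      using assms(5) L.zero_mem by (intro comm) (auto simp: S_def)
  qed
  then have "(EXP ?y * (?x - ?y) * EXP (- ?y) - (?x - ?y)) $ i + (?x - ?y) $ i \<in> L" for i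
    using assms(5) L.zero_mem by (intro L.add_mem) (auto simp: S_def)
  then have "(EXP (- z) * fps_euler (EXP z)) $ i \<in> L" for i
    by (simp add: eq)
  note coeffs = texp_log_coeffs_mem[OF assms(1) bracket z(1) this]
  have "fps_eval n 1 z \<in> L" by (simp add: fps_eval_def L.sum_mem coeffs)
  moreover have "EXP (fps_eval n 1 z) = EXP x * EXP (- y)"
    unfolding fps_eval_texp[OF z(1), symmetric] z(2)
    by (simp add: fps_eval_mult W.texp_mem mx mmy fps_eval_texp fps_eval_uminus fps_eval_monom x y)
  ultimately show ?thesis using fps_eval_mem[OF z(1)] by blast
qed

end

end

section \<open>Affine endomorphisms\<close>

lemma nsm_0 [simp]: "nsm 0 a = 0" by (simp add: nsm_def)
lemma nsm_Suc [simp]: "nsm (Suc k) a = a + nsm k a" by (simp add: nsm_def add.commute)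
lemma nsm_zero [simp]: "nsm k 0 = 0" by (simp add: nsm_def)
lemma nsm_add: "nsm (k + l) a = nsm k a + nsm l a" by (induction k) (auto simp: add.assoc)
lemma nsm_plus: "nsm k (a + b) = nsm k a + nsm k b" by (simp add: nsm_def sum.distrib)
lemma nsm_uminus: "nsm k (- a) = - nsm k a" by (simp add: nsm_def sum_negf)
lemma nsm_mult: "nsm (k * l) a = nsm k (nsm l a)" by (induction k) (auto simp: nsm_add)
lemma nsm_Pair0: "nsm k (0, b) = (0, nsm k b)" by (induction k) (auto simp: zero_prod_def)

lemma nsm_additive:
  assumes "\<And>x y. f (x + y) = f x + f y" shows "f (nsm k x) = nsm k (f x)"
proof (induction k)
  case 0
  have "f 0 + f 0 = f 0 + 0" using assms[of 0 0] by simp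
  then show ?case by (simp only: add_left_cancel nsm_0)
qed (simp add: assms)

definition zmul :: "int \<Rightarrow> 'a::ab_group_add \<Rightarrow> 'a" where
  "zmul k a = nsm (nat k) a - nsm (nat (- k)) a"

lemma zmul_diff_nat: "zmul (int i - int j) a = nsm i a - nsm j a"
proof -
  have "nat (int i - int j) + j = i + nat (- (int i - int j))" by linarith
  then have "nsm (nat (int i - int j)) a + nsm j a = nsm i a + nsm (nat (- (int i - int j))) a"
    by (metis nsm_add)
  then show ?thesis by (simp add: zmul_def algebra_simps)
qed

lemma zmul_add: "zmul (k + l) a = zmul k a + zmul l a"
proof -
  have "k + l = int (nat k + nat l) - int (nat (- k) + nat (- l))" by linarith
  then have "zmul (k + l) a = nsm (nat k + nat l) a - nsm (nat (- k) + nat (- l)) a"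
    using zmul_diff_nat by metis
  then show ?thesis by (simp add: zmul_def nsm_add)
qed

lemma zmul_0 [simp]: "zmul 0 a = 0" and zmul_1 [simp]: "zmul 1 a = a"
  by (simp_all add: zmul_def)

text \<open>Affine maps of \<open>A\<close> are represented linearly on \<open>\<int> \<times> A\<close>; an affine vector field
  \<open>b \<mapsto> v + f b\<close> acts there by \<open>(k, b) \<mapsto> (0, k v + f b)\<close>.\<close>

typedef (overloaded) 'a zendo = "{f :: int \<times> 'a::ab_group_add \<Rightarrow> int \<times> 'a. \<forall>x y. f (x + y) = f x + f y}"
  morphisms zapp Zendo
  by (intro exI[of _ "\<lambda>x. x"]) simp

lemma zapp_add_right: "zapp f (u + v) = zapp f u + zapp f v"
  using zapp[of f] by blast

lemma zapp_Zendo: "(\<And>x y. f (x + y) = f x + f y) \<Longrightarrow> zapp (Zendo f) = f"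
  by (rule Zendo_inverse) blast

lemma zapp_0_right [simp]: "zapp f 0 = 0"
  using zapp_add_right[of f 0 0] by (metis add_cancel_right_right add_0)

lemma zapp_uminus_right: "zapp f (- u) = - zapp f u"
  using zapp_add_right[of f u "- u"] by (simp add: eq_neg_iff_add_eq_0 add.commute)

lemma zapp_diff_right: "zapp f (u - v) = zapp f u - zapp f v"
  using zapp_add_right[of f u "- v"] by (simp add: zapp_uminus_right)

lemma zapp_sum_right: "zapp f (sum g I) = (\<Sum>i\<in>I. zapp f (g i))"
  by (induction I rule: infinite_finite_induct) (auto simp: zapp_add_right)

lemma zapp_nsm_right: "zapp f (nsm k u) = nsm k (zapp f u)"
  by (rule nsm_additive) (rule zapp_add_right)

instantiation zendo :: (ab_group_add) ring_1
begin

definition "0 = Zendo (\<lambda>_. 0)"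
definition "1 = Zendo (\<lambda>u. u)"
definition "f + g = Zendo (\<lambda>u. zapp f u + zapp g u)"
definition "- f = Zendo (\<lambda>u. - zapp f u)"
definition "f - g = Zendo (\<lambda>u. zapp f u - zapp g u)"
definition "f * g = Zendo (\<lambda>u. zapp f (zapp g u))"

lemma zapp_ring_simps [simp]:
  "zapp 0 u = 0" "zapp 1 u = u" "zapp (f + g) u = zapp f u + zapp g u"
  "zapp (- f) u = - zapp f u" "zapp (f - g) u = zapp f u - zapp g u"
  "zapp (f * g) u = zapp f (zapp g u)"
  unfolding zero_zendo_def one_zendo_def plus_zendo_def uminus_zendo_def minus_zendo_def times_zendo_def
  by (subst zapp_Zendo; simp add: zapp_add_right algebra_simps)+

instance
proof
  \<comment> \<open>The factor int keeps 0 and 1 apart even when A is trivial.\<close>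
  show "(0 :: 'a zendo) \<noteq> 1"
  proof
    assume "(0 :: 'a zendo) = 1"
    then have "zapp (0 :: 'a zendo) (1, 0) = zapp 1 (1, 0)" by simp
    then show False by (simp add: zero_prod_def)
  qed
qed (simp_all add: zapp_inject[symmetric] fun_eq_iff zapp_add_right algebra_simps)

end

lemma zapp_of_nat [simp]: "zapp (of_nat c) u = nsm c u"
  by (induction c) auto

lemma zapp_sum [simp]: "zapp (sum f I) u = (\<Sum>i\<in>I. zapp (f i) u)"
  by (induction I rule: infinite_finite_induct) auto

lemma zendo_eqI:
  assumes 1: "zapp f (1, 0) = zapp g (1, 0)" and 2: "\<And>b. zapp f (0, b) = zapp g (0, b)"
  shows "f = g"
proof -
  have k: "zapp f (k, 0) = zapp g (k, 0)" for k
  proof (induction k rule: int_induct[where k = 0])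
    case base
    show ?case by (rule 2)
  next
    case (step1 i)
    then show ?case using 1 zapp_add_right[of f "(i, 0)" "(1, 0)"] zapp_add_right[of g "(i, 0)" "(1, 0)"] by simp
  next
    case (step2 i)
    then show ?case using 1 zapp_diff_right[of f "(i, 0)" "(1, 0)"] zapp_diff_right[of g "(i, 0)" "(1, 0)"] by simp
  qed
  have "zapp f (k, b) = zapp g (k, b)" for k b
    using k 2 zapp_add_right[of f "(k, 0)" "(0, b)"] zapp_add_right[of g "(k, 0)" "(0, b)"] by simp
  then show ?thesis by (simp add: zapp_inject[symmetric] fun_eq_iff)
qed

text \<open>e = 1 gives an affine map, seen on the hyperplane k = 1; e = 0 gives an affine vector
  field.\<close>

definition zaff :: "int \<Rightarrow> 'a::ab_group_add \<Rightarrow> ('a \<Rightarrow> 'a) \<Rightarrow> 'a zendo" where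
  "zaff e v f = Zendo (\<lambda>(k, b). (e * k, zmul k v + f b))"

lemma zapp_zaff:
  assumes "\<And>x y. f (x + y) = f x + f y"
  shows "zapp (zaff e v f) (k, b) = (e * k, zmul k v + f b)"
  unfolding zaff_def by (subst zapp_Zendo) (auto simp: assms zmul_add algebra_simps)

text \<open>Recovers x u from (exp x - 1) u: modulo powers of x higher than k + 1 applied to u,
  x^(k+1) u equals x^k (exp x - 1) u, so downward induction on k works for nilpotent x.\<close>

lemma zapp_texp_diff_mem:
  fixes x :: "'a::ab_group_add zendo"
  assumes S: "plus_subgroup S" "\<And>u. u \<in> S \<Longrightarrow> zapp x u \<in> S"
    and x: "x ^ Suc n = 0" "dpow K x 1 = x" and u: "zapp (texp K n x) u - u \<in> S"
  shows "zapp x u \<in> S"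
proof (cases n)
  case 0
  then show ?thesis using x plus_subgroup.zero_mem[OF S(1)] by simp
next
  case (Suc m)
  interpret S: plus_subgroup S by fact
  have pow0: "x ^ k = 0" if "n < k" for k
    using that x(1) power_add[of x "Suc n" "k - Suc n"] by simp
  have pow_mem: "zapp (x ^ k) v \<in> S" if "v \<in> S" for k v
    by (induction k) (auto simp: that S)
  have nsm_mem: "nsm c v \<in> S" if "v \<in> S" for c v
    using that by (induction c) (auto simp: S.zero_mem S.add_mem)
  have "zapp (x ^ Suc k) u \<in> S" for k
  proof (induction "n - k" arbitrary: k rule: less_induct)
    case less
    show ?case
    proof (cases "k < n")
      case False
      then show ?thesis using pow0[of "Suc k"] S.zero_mem by simp
    next
      case True
      have "texp K n x = 1 + (x + (\<Sum>i<m. dpow K x (Suc (Suc i))))"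
        unfolding texp_def Suc using x(2)
        by (simp only: sum.atMost_shift lessThan_Suc_atMost) (simp add: dpow_def sum.lessThan_Suc_shift flip: Suc)
      moreover have "zapp (x ^ k) (zapp (dpow K x i) u) = nsm (rfact K i) (zapp (x ^ (k + i)) u)" for i
        by (simp add: dpow_def zapp_nsm_right power_add)
      moreover have "zapp (x ^ k) (zapp x u) = zapp (x ^ Suc k) u"
        by (simp add: power_commutes flip: zapp_ring_simps(6))
      ultimately have "zapp (x ^ k) (zapp (texp K n x) u - u) - zapp (x ^ Suc k) u
          = (\<Sum>i<m. nsm (rfact K (Suc (Suc i))) (zapp (x ^ Suc (k + Suc i)) u))"
        by (simp add: zapp_add_right zapp_sum_right del: power_Suc rfact.simps)
      also have "\<dots> \<in> S"
        using True by (intro S.sum_mem nsm_mem less) auto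
      finally have "zapp (x ^ k) (zapp (texp K n x) u - u) - (zapp (x ^ k) (zapp (texp K n x) u - u) - zapp (x ^ Suc k) u) \<in> S"
        by (rule S.diff_mem[OF pow_mem[OF u]])
      then show ?thesis by simp
    qed
  qed
  from this[of 0] show ?thesis by simp
qed

lemma zapp_texp_fixed:
  assumes "zapp x u = 0" shows "zapp (texp K n x) u = u"
proof -
  have "zapp (dpow K x k) u = (if k = 0 then u else 0)" for k
    using assms by (cases k) (auto simp: dpow_def power_Suc2 simp del: power_Suc)
  then show ?thesis by (simp add: texp_def)
qed

section \<open>The filtration given by a chain of subgroups\<close>

locale affine_chain =
  fixes C :: "nat \<Rightarrow> 'a::ab_group_add set" and p n :: nat
  assumes prime_p: "Factorial_Ring.prime p" and n_small: "2 ^ n < p"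
    and torsion: "nsm (p ^ n) (a :: 'a) = 0"
    and C_subgroup: "plus_subgroup (C k)"
    and C_0: "C 0 = {0}" and C_mono: "C k \<subseteq> C (Suc k)" and C_top: "C n = UNIV"
begin

text \<open>A descending chain from int x A = \<open>B 0\<close> through 0 x A = \<open>B 1\<close>
  to \<open>B (n + 1)\<close> = 0. The int component accounts for the extra step: \<open>C n\<close>
  and \<open>C (n + 1)\<close> are both everything.\<close>

definition B :: "nat \<Rightarrow> (int \<times> 'a) set" where
  "B k = {(i, b). (k = 0 \<or> i = 0) \<and> b \<in> C (Suc n - k)}"

definition F :: "nat \<Rightarrow> 'a zendo set" where
  "F j = {f. \<forall>k. \<forall>u\<in>B k. zapp f u \<in> B (k + j)}"

lemma C_Suc_n: "C (Suc n) = UNIV"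
  using C_top C_mono by blast

lemma B_subgroup: "plus_subgroup (B k)"
proof -
  define m where "m = Suc n - k"
  interpret plus_subgroup "C m" by (rule C_subgroup)
  have B_eq: "B k = {u. (k = 0 \<or> fst u = 0) \<and> snd u \<in> C m}" by (auto simp: B_def m_def)
  show ?thesis
  proof (cases "k = 0")
    case True
    then have "B k = {u. snd u \<in> C m}" using B_eq by simp
    then show ?thesis by unfold_locales (simp_all add: zero_mem add_mem uminus_mem)
  next
    case False
    then have "B k = {u. fst u = 0 \<and> snd u \<in> C m}" using B_eq by simp
    then show ?thesis by unfold_locales (simp_all add: zero_mem add_mem uminus_mem)
  qed
qed

lemma B_Suc: "B (Suc k) \<subseteq> B k"
  using C_mono[of "n - k"] by (cases "k \<le> n") (auto simp: B_def Suc_diff_le)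

lemma B_0: "B 0 = UNIV" and B_1: "B (Suc 0) = {0} \<times> UNIV" and B_top: "n < k \<Longrightarrow> B k = {0}"
  using C_Suc_n C_top C_0 by (auto simp: B_def zero_prod_def)

sublocale filtered_ring F p n
proof
  show "Factorial_Ring.prime p" "2 ^ n < p" by (fact prime_p n_small)+
  fix k
  show "0 \<in> F k" using plus_subgroup.zero_mem[OF B_subgroup] by (auto simp: F_def)
  show "x + y \<in> F k" if "x \<in> F k" "y \<in> F k" for x y
    using that plus_subgroup.add_mem[OF B_subgroup] by (auto simp: F_def)
  show "- x \<in> F k" if "x \<in> F k" for x
    using that plus_subgroup.uminus_mem[OF B_subgroup] by (auto simp: F_def)
  show "F (Suc k) \<subseteq> F k" using B_Suc by (fastforce simp: F_def)
  show "1 \<in> F 0" by (auto simp: F_def)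
  show "x * y \<in> F (i + j)" if "x \<in> F i" "y \<in> F j" for x y i j
    using that by (auto simp: F_def) (metis add.assoc add.commute)
  show "x = 0" if "x \<in> F (Suc n)" for x
  proof -
    have "zapp x u \<in> B (0 + Suc n)" for u using that B_0 unfolding F_def by blast
    then have "zapp x u = 0" for u using B_top[of "0 + Suc n"] by simp
    then show ?thesis by (intro zendo_eqI) auto
  qed
  show "of_nat (p ^ n) * x = 0" if "x \<in> F (Suc 0)" for x
  proof -
    have "zapp (of_nat (p ^ n) * x) u = 0" for u
    proof -
      have "zapp x u \<in> B (0 + Suc 0)" using that B_0 unfolding F_def by blast
      then obtain b where "zapp x u = (0, b)" using B_1 by auto
      then show ?thesis
        by (simp add: nsm_Pair0 torsion zero_prod_def del: of_nat_power)
    qed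
    then show ?thesis by (intro zendo_eqI) auto
  qed
qed

text \<open>Serves to compare two pre-Lie products, whose chains may differ: a logarithm that is
  nilpotent for another reason is placed into the filtration of this chain by means of its
  exponential.\<close>

lemma F_1_I:
  assumes "x ^ Suc n = 0" "E x 1 = x" "\<And>u. fst (zapp x u) = 0" "EXP x - 1 \<in> F (Suc 0)"
  shows "x \<in> F (Suc 0)"
proof -
  have "zapp x u \<in> B (Suc k)" if "u \<in> B k" for u k
    using that
  proof (induction "Suc n - k" arbitrary: u k rule: less_induct)
    case less
    show ?case
    proof (cases "n < k")
      case True
      then show ?thesis using less B_top by simp
    next
      case False
      show ?thesis
      proof (rule zapp_texp_diff_mem[OF B_subgroup _ assms(1,2)])
        show "zapp x v \<in> B (Suc k)" if "v \<in> B (Suc k)" for v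
          using less.hyps[OF _ that] False B_Suc[of "Suc k"] by auto
        show "zapp (EXP x) u - u \<in> B (Suc k)"
          using assms(4) less.prems by (auto simp: F_def)
      qed
    qed
  qed
  then show ?thesis by (auto simp: F_def)
qed

end

lemma ndiv_eq:
  fixes x :: "'a::ab_group_add"
  assumes torsion: "\<And>a :: 'a. nsm M a = 0" and "[k * r = 1] (mod M)"
  shows "ndiv x k = nsm r x"
proof -
  obtain q s where qs: "k * r + q * M = 1 + s * M"
    using assms(2) by (metis cong_iff_lin_nat mult.commute)
  have *: "nsm (k * r) a = a" for a :: 'a
    using arg_cong[OF qs, of "\<lambda>m. nsm m a"] by (simp add: nsm_add nsm_mult torsion)
  show ?thesis
    unfolding ndiv_def
  proof (rule the_equality)
    show "nsm k (nsm r x) = x" using * by (simp add: nsm_mult)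
    show "y = nsm r x" if "nsm k y = x" for y
      using *[of y] that by (metis mult.commute nsm_mult)
  qed
qed

section \<open>The group of flows\<close>

definition add_monoid_rec :: "'a::ab_group_add monoid" where
  "add_monoid_rec = \<lparr>carrier = UNIV, monoid.mult = (+), one = 0\<rparr>"

lemma group_add_monoid_rec: "group (add_monoid_rec :: 'a::ab_group_add monoid)"
proof (rule groupI)
  show "\<exists>y\<in>carrier add_monoid_rec. y \<otimes>\<^bsub>add_monoid_rec\<^esub> x = \<one>\<^bsub>add_monoid_rec\<^esub>" for x :: 'a
    by (rule bexI[of _ "- x"]) (auto simp: add_monoid_rec_def)
qed (auto simp: add_monoid_rec_def add.assoc)

lemma card_plus_cosets:
  fixes S :: "'a::{finite, ab_group_add} set"
  assumes "plus_subgroup S"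
  shows "card (range (\<lambda>b. (+) b ` S)) * card S = card (UNIV :: 'a set)"
proof -
  interpret S: plus_subgroup S by fact
  interpret G: group "add_monoid_rec :: 'a monoid" by (rule group_add_monoid_rec)
  have inv: "inv\<^bsub>add_monoid_rec\<^esub> x = - x" for x :: 'a
    by (rule G.inv_equality) (auto simp: add_monoid_rec_def)
  have "subgroup S add_monoid_rec"
    by (rule G.subgroupI) (auto simp: inv S.uminus_mem, auto simp: add_monoid_rec_def S.add_mem intro: S.zero_mem)
  moreover have "rcosets\<^bsub>add_monoid_rec\<^esub> S = range (\<lambda>b. (+) b ` S)"
    by (auto simp: RCOSETS_def r_coset_def add_monoid_rec_def add.commute)
  ultimately show ?thesis using G.lagrange[of S] by (simp add: order_def add_monoid_rec_def)
qed

lemma nsm_card_UNIV: "nsm (card (UNIV :: 'a set)) (x :: 'a::{finite, ab_group_add}) = 0"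
proof -
  interpret G: group "add_monoid_rec :: 'a monoid" by (rule group_add_monoid_rec)
  have "x [^]\<^bsub>add_monoid_rec\<^esub> k = nsm k x" for k :: nat
    by (induction k) (auto simp: add_monoid_rec_def nat_pow_def add.commute)
  then show ?thesis using G.pow_order_eq_1[of x] by (simp add: order_def add_monoid_rec_def)
qed

text \<open>The cardinalities are powers of p and grow until the chain is full, so k proper steps
  give at least p^k elements. This ties the length of the filtration to the exponent n.\<close>

lemma plus_subgroup_chain_top:
  fixes C :: "nat \<Rightarrow> 'a::{finite, ab_group_add} set"
  assumes p: "Factorial_Ring.prime p" and card: "card (UNIV :: 'a set) = p ^ n"
    and C: "\<And>k. plus_subgroup (C k)" "\<And>k. C k \<subseteq> C (Suc k)" "\<And>k. C (Suc k) = C k \<Longrightarrow> C k = UNIV"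
  shows "C n = UNIV"
proof -
  have pow: "\<exists>j. card (C k) = p ^ j" for k
    using card_plus_cosets[OF C(1)[of k]] divides_primepow_nat[OF p] card by (metis dvd_triv_right)
  have "C k = UNIV \<or> p ^ k \<le> card (C k)" for k
  proof (induction k)
    case 0
    have "C 0 \<noteq> {}" using plus_subgroup.zero_mem[OF C(1)] by blast
    then show ?case by (simp add: Suc_leI card_gt_0_iff)
  next
    case (Suc k)
    show ?case
    proof (cases "C k = UNIV")
      case True
      then show ?thesis using C(2) by blast
    next
      case False
      then have lt: "card (C k) < card (C (Suc k))"
        using C(2,3) by (intro psubset_card_mono) auto
      obtain i j where ij: "card (C k) = p ^ i" "card (C (Suc k)) = p ^ j" using pow by metis
      have p1: "1 < p" using prime_gt_1_nat[OF p] by simp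
      have "i < j" using lt p1 unfolding ij by (simp add: power_strict_increasing_iff)
      moreover have "k \<le> i" using Suc False p1 ij by (simp add: power_increasing_iff)
      ultimately have "p ^ Suc k \<le> p ^ j" using p1 by (intro power_increasing) auto
      then show ?thesis using ij by simp
    qed
  qed
  from this[of n] show ?thesis
    by (metis card card_seteq finite subset_UNIV)
qed

text \<open>The group laws are transported along H, which is injective by its value at the origin.
  The brace law is the additivity of \<open>H a\<close> applied to (1, b + c) + (1, 0) = (1, b) +
  (1, c).\<close>

lemma is_brace_of_representation:
  fixes circ :: "'a::ab_group_add \<Rightarrow> 'a \<Rightarrow> 'a" and H :: "'a \<Rightarrow> 'a zendo"
  assumes H_mult: "\<And>a b. H (circ a b) = H a * H b" and H_0: "H 0 = 1"
    and H_inv: "\<And>a. \<exists>b. H b * H a = 1"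
    and H_app: "\<And>a b. zapp (H a) (1, b) = (1, circ a b)" and H_base: "\<And>a. zapp (H a) (1, 0) = (1, a)"
  shows "is_brace circ" "\<one>\<^bsub>adj_group circ\<^esub> = 0"
proof -
  have H_inj: "a = b" if "H a = H b" for a b
    using that H_base by (metis prod.inject)
  have id: "circ 0 x = x" "circ x 0 = x" for x
    using H_inj[of "circ 0 x" x] H_inj[of "circ x 0" x] by (simp_all add: H_mult H_0)
  then show one: "\<one>\<^bsub>adj_group circ\<^esub> = 0"
    unfolding adj_group_def by (auto intro!: the_equality) (metis id)
  have "group (adj_group circ)"
  proof (rule groupI)
    show "\<exists>y\<in>carrier (adj_group circ). y \<otimes>\<^bsub>adj_group circ\<^esub> x = \<one>\<^bsub>adj_group circ\<^esub>" for x
    proof -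
      obtain y where "H y * H x = 1" using H_inv by blast
      then have "circ y x = 0" by (intro H_inj) (simp add: H_mult H_0)
      then show ?thesis unfolding one by (auto simp: adj_group_def)
    qed
    show "x \<otimes>\<^bsub>adj_group circ\<^esub> y \<otimes>\<^bsub>adj_group circ\<^esub> z = x \<otimes>\<^bsub>adj_group circ\<^esub> (y \<otimes>\<^bsub>adj_group circ\<^esub> z)" for x y z
      by (simp add: adj_group_def) (rule H_inj, simp add: H_mult mult.assoc)
  qed (unfold one, simp_all add: adj_group_def id)
  moreover have "circ a (b + c) + a = circ a b + circ a c" for a b c
  proof -
    have "zapp (H a) (1, b + c) + zapp (H a) (1, 0) = zapp (H a) (1, b) + zapp (H a) (1, c)"
      by (simp flip: zapp_add_right)
    then show ?thesis by (simp add: H_app id)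
  qed
  ultimately show "is_brace circ" by (simp add: is_brace_def)
qed

text \<open>The largest chain starting at 0 that left multiplications lower by one step. It is used
  for pre-Lie products and also for \<open>star\<close> of a brace, which is additive in its second
  argument but in general not in its first.\<close>

primrec left_chain :: "('a::ab_group_add \<Rightarrow> 'a \<Rightarrow> 'a) \<Rightarrow> nat \<Rightarrow> 'a set" where
  "left_chain mul 0 = {0}"
| "left_chain mul (Suc k) = {b. \<forall>a. mul a b \<in> left_chain mul k}"

lemma left_chain_plus_subgroup:
  assumes add: "\<And>x y z. mul x (y + z) = mul x y + mul x z"
  shows "plus_subgroup (left_chain mul k)"
proof (induction k)
  case (Suc k)
  then interpret plus_subgroup "left_chain mul k" .
  have 0: "mul x 0 = 0" for x using add[of x 0 0] by (metis add_cancel_right_right add_0)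
  have "mul x (- y) = - mul x y" for x y
    using add[of x y "- y"] 0 by (simp add: eq_neg_iff_add_eq_0 add.commute)
  then show ?case
    by unfold_locales (simp_all add: zero_mem add_mem uminus_mem add 0)
qed (unfold_locales, auto)

lemma left_chain_subset_Suc: "(\<And>x. mul x 0 = 0) \<Longrightarrow> left_chain mul k \<subseteq> left_chain mul (Suc k)"
  by (induction k) auto

lemma (in affine_chain) zaff_mem:
  assumes add: "\<And>x y. f (x + y) = f x + f y" and f: "\<And>k b. b \<in> C (Suc k) \<Longrightarrow> f b \<in> C k"
  shows "zaff 0 v f \<in> F (Suc 0)"
proof -
  have f0: "f 0 = 0" using add[of 0 0] by (metis add_cancel_right_right add_0)
  have "zapp (zaff 0 v f) (i, b) \<in> B (Suc k)" if "(i, b) \<in> B k" for i b k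
  proof (cases "k = 0 \<or> n < k")
    case True
    then show ?thesis using that B_1 B_top[of k] B_top[of "Suc k"] f0 by (auto simp: zapp_zaff add zero_prod_def)
  next
    case False
    then have "Suc n - k = Suc (n - k)" by (simp add: Suc_diff_le)
    then show ?thesis using that False f by (auto simp: B_def zapp_zaff add)
  qed
  then show ?thesis by (auto simp: F_def)
qed

section \<open>The brace of a left nilpotent pre-Lie ring\<close>

locale flow_pre_lie =
  fixes mul :: "'a::{finite, ab_group_add} \<Rightarrow> 'a \<Rightarrow> 'a" and p n :: nat
  assumes p_prime: "Factorial_Ring.prime p" and p_large: "2 ^ n < p"
    and card_UNIV: "card (UNIV :: 'a set) = p ^ n"
    and pre_lie: "pre_lie mul" and left_nilpotent: "left_nilpotent mul"
begin

lemma mul_add_left: "mul (x + y) z = mul x z + mul y z"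
  and mul_add_right: "mul x (y + z) = mul x y + mul x z"
  and pre_lie_id: "mul (mul x y) z - mul x (mul y z) = mul (mul y x) z - mul y (mul x z)"
  using pre_lie unfolding pre_lie_def by blast+

lemma mul_0_right [simp]: "mul x 0 = 0"
  using mul_add_right[of x 0 0] by (metis add_cancel_right_right add_0)

lemma mul_0_left [simp]: "mul 0 x = 0"
  using mul_add_left[of 0 0 x] by (metis add_cancel_right_right add_0)

lemma mul_uminus_left: "mul (- x) y = - mul x y"
  using mul_add_left[of x "- x" y] by (simp add: eq_neg_iff_add_eq_0 add.commute)

lemmas left_chain_subgroup = left_chain_plus_subgroup[of mul, OF mul_add_right]
lemmas left_chain_mono = left_chain_subset_Suc[of mul, OF mul_0_right]

lemma rnest_Cons: "as \<noteq> [] \<Longrightarrow> rnest mul (a # as) = mul a (rnest mul as)"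
  by (cases as) auto

text \<open>If the chain stalls, an element outside it has a left multiple outside it; iterating
  gives nonzero right-nested products of every length.\<close>

lemma left_chain_strict:
  assumes eq: "left_chain mul (Suc k) = left_chain mul k" shows "left_chain mul k = UNIV"
proof (rule ccontr)
  assume "left_chain mul k \<noteq> UNIV"
  then obtain b where b: "b \<notin> left_chain mul k" by blast
  have "\<exists>as. length as = Suc m \<and> rnest mul as \<notin> left_chain mul k" for m
  proof (induction m)
    case 0
    show ?case using b by (intro exI[of _ "[b]"]) simp
  next
    case (Suc m)
    then obtain as where as: "length as = Suc m" "rnest mul as \<notin> left_chain mul (Suc k)"
      unfolding eq by blast
    then obtain a where "mul a (rnest mul as) \<notin> left_chain mul k" by auto
    then moreover have "as \<noteq> []" using as by auto
    ultimately show ?case using as rnest_Cons[of as a] by (intro exI[of _ "a # as"]) auto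
  qed
  moreover obtain m where "\<And>as. length as = Suc m \<Longrightarrow> rnest mul as = 0"
    using left_nilpotent unfolding left_nilpotent_def by (metis Suc_pred)
  ultimately show False using plus_subgroup.zero_mem[OF left_chain_subgroup] by metis
qed

lemma nsm_torsion: "nsm (p ^ n) (a :: 'a) = 0"
  using nsm_card_UNIV[of a] by (simp add: card_UNIV)

sublocale affine_chain "left_chain mul" p n
proof
  show "left_chain mul n = UNIV"
    by (rule plus_subgroup_chain_top[where C = "left_chain mul", OF p_prime card_UNIV
          left_chain_subgroup left_chain_mono left_chain_strict])
  show "left_chain mul k \<subseteq> left_chain mul (Suc k)" for k by (rule left_chain_mono)
qed (simp_all add: p_prime p_large nsm_torsion plus_subgroup.zero_mem[OF left_chain_subgroup]
    plus_subgroup.add_mem[OF left_chain_subgroup] plus_subgroup.uminus_mem[OF left_chain_subgroup])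

definition vf :: "'a \<Rightarrow> 'a zendo" where "vf a = zaff 0 a (mul a)"

lemma zapp_vf [simp]: "zapp (vf a) (k, b) = (0, zmul k a + mul a b)"
  by (simp add: vf_def zapp_zaff mul_add_right)

lemma vf_mem: "vf a \<in> F (Suc 0)"
  unfolding vf_def by (rule zaff_mem) (simp_all add: mul_add_right)

lemma vf_add: "vf (a + b) = vf a + vf b"
  by (rule zendo_eqI) (auto simp: mul_add_left)

lemma vf_0 [simp]: "vf 0 = 0"
  by (rule zendo_eqI) (auto simp: zero_prod_def)

lemma vf_uminus: "vf (- a) = - vf a"
  by (rule zendo_eqI) (auto simp: mul_uminus_left)

lemma vf_nsm: "vf (nsm c a) = of_nat c * vf a"
  by (induction c) (auto simp: vf_add distrib_right)

text \<open>The value at the origin is a b - b a, and equality of the linear parts is exactly the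
  pre-Lie identity.\<close>

lemma vf_commutator: "vf a * vf b - vf b * vf a = vf (mul a b - mul b a)"
proof (rule zendo_eqI)
  fix c
  have "mul (mul a b - mul b a) c = mul a (mul b c) - mul b (mul a c)"
  proof -
    have "mul (mul a b - mul b a) c = mul (mul a b) c - mul (mul b a) c"
      using mul_add_left[of "mul a b" "- mul b a" c] by (simp add: mul_uminus_left)
    then show ?thesis using pre_lie_id[of a b c] by (simp only:) (simp add: algebra_simps)
  qed
  then show "zapp (vf a * vf b - vf b * vf a) (0, c) = zapp (vf (mul a b - mul b a)) (0, c)"
    by simp
qed simp

lemma vf_inj: assumes "vf a = vf b" shows "a = b"
proof -
  have "zapp (vf c) (1, 0) = (0, c)" for c by simp
  then show ?thesis using assms by (metis prod.inject)
qed

lemma vf_subgroup: "plus_subgroup S \<Longrightarrow> plus_subgroup (vf ` S)"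
proof -
  assume "plus_subgroup S"
  then interpret plus_subgroup S .
  show ?thesis
  proof
    show "0 \<in> vf ` S" using zero_mem vf_0 by (metis imageI)
    show "x + y \<in> vf ` S" if "x \<in> vf ` S" "y \<in> vf ` S" for x y
      using that add_mem by (auto simp flip: vf_add)
    show "- x \<in> vf ` S" if "x \<in> vf ` S" for x
      using that uminus_mem by (auto simp flip: vf_uminus)
  qed
qed

lemma zapp_vf_power: "zapp (vf a ^ k) (0, b) = (0, Lpow mul a k b)"
  by (induction k) (auto simp: Lpow_def)

lemma zapp_vf_power_Suc: "zapp (vf a ^ Suc k) (1, 0) = (0, Lpow mul a k a)"
  by (simp add: power_Suc2 zapp_vf_power del: power_Suc)

lemma vf_power_top: "vf a ^ Suc n = 0"
  using F_top[OF F_power[OF vf_mem]] .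

lemma fact_rfact_cong: "k \<le> n \<Longrightarrow> [fact k * rfact (p ^ n) k = 1] (mod p ^ n)"
proof (induction k)
  case (Suc k)
  have "coprime (Suc k) (p ^ n)" using coprime_small[of "Suc k"] n_less_p Suc.prems by simp
  then have "[(Suc k * rcp (p ^ n) (Suc k)) * (fact k * rfact (p ^ n) k) = 1 * 1] (mod p ^ n)"
    using Suc by (intro cong_mult rcp_cong) auto
  also have "(Suc k * rcp (p ^ n) (Suc k)) * (fact k * rfact (p ^ n) k) = fact (Suc k) * rfact (p ^ n) (Suc k)"
    by (simp only: fact_Suc rfact.simps of_nat_id ac_simps)
  finally show ?case by simp
qed simp

lemma ndiv_fact: "k \<le> n \<Longrightarrow> ndiv (x :: 'a) (fact k) = nsm (rfact (p ^ n) k) x"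
  by (rule ndiv_eq[OF nsm_torsion fact_rfact_cong])

lemma Lpow_zero_mono: "i \<le> j \<Longrightarrow> Lpow mul a i b = 0 \<Longrightarrow> Lpow mul a j b = 0"
  by (induction j rule: dec_induct) (auto simp: Lpow_def)

lemma Lpow_top: "Lpow mul a (Suc n) b = 0" "Lpow mul a n a = 0"
  using zapp_vf_power[of a "Suc n" b] zapp_vf_power_Suc[of a n] vf_power_top[of a]
  by (simp_all add: zero_prod_def del: power_Suc)

text \<open>\<open>expL\<close> and \<open>Wf\<close> stop at the first vanishing power, which
  depends on the arguments; the later powers vanish too, so a fixed number of terms can be
  summed.\<close>

lemma sum_to_Least:
  assumes top: "Lpow mul a N b = 0" and g: "\<And>k. k < N \<Longrightarrow> g k (Lpow mul a k b) = nsm (h k) (Lpow mul a k b)"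
  shows "(\<Sum>k < (LEAST m. Lpow mul a m b = 0). g k (Lpow mul a k b)) = (\<Sum>k<N. nsm (h k) (Lpow mul a k b))"
proof -
  define m where "m = (LEAST m. Lpow mul a m b = 0)"
  have m: "Lpow mul a m b = 0" unfolding m_def using top by (rule LeastI)
  have le: "m \<le> N" unfolding m_def using top by (rule Least_le)
  have "(\<Sum>k<m. g k (Lpow mul a k b)) = (\<Sum>k<m. nsm (h k) (Lpow mul a k b))"
    using le by (intro sum.cong g) auto
  also have "\<dots> = (\<Sum>k<N. nsm (h k) (Lpow mul a k b))"
    using le by (intro sum.mono_neutral_left) (simp_all add: Lpow_zero_mono[OF _ m])
  finally show ?thesis by (simp only: m_def)
qed

lemma zapp_texp_vf_0: "zapp (EXP (vf a)) (0, b) = (0, expL mul a b)"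
proof -
  have "expL mul a b = (\<Sum>k\<le>n. nsm (rfact (p ^ n) k) (Lpow mul a k b))"
    unfolding expL_def lessThan_Suc_atMost[symmetric]
    by (rule sum_to_Least[OF Lpow_top(1), where g = "\<lambda>k x. ndiv x (fact k)"]) (rule ndiv_fact, simp)
  then show ?thesis
    by (simp add: texp_def dpow_def zapp_vf_power nsm_Pair0 prod_eq_iff fst_sum snd_sum)
qed

text \<open>\<open>Wf mul a\<close> is the point that the flow of \<open>vf a\<close> reaches from
  the origin at time 1. The first application of \<open>vf a\<close> produces a itself, hence the
  shift between factorials and powers.\<close>

lemma zapp_texp_vf_1: "zapp (EXP (vf a)) (1, 0) = (1, Wf mul a)"
proof -
  have "Wf mul a = (\<Sum>k<n. nsm (rfact (p ^ n) (Suc k)) (Lpow mul a k a))"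
    unfolding Wf_def
    by (rule sum_to_Least[OF Lpow_top(2), where g = "\<lambda>k x. ndiv x (fact (Suc k))"]) (rule ndiv_fact, simp)
  moreover have "zapp (EXP (vf a)) (1, 0) = (1, 0) + (\<Sum>k<n. zapp (E (vf a) (Suc k)) (1, 0))"
    unfolding texp_def by (simp add: sum.atMost_shift del: rfact.simps)
  moreover have "zapp (E (vf a) (Suc k)) (1, 0) = (0, nsm (rfact (p ^ n) (Suc k)) (Lpow mul a k a))" for k
    unfolding dpow_def zapp_ring_simps zapp_vf_power_Suc by (simp only: zapp_of_nat nsm_Pair0)
  ultimately show ?thesis by (simp add: prod_eq_iff fst_sum snd_sum)
qed

lemma ex_texp_vf_mult: "\<exists>c. EXP (vf c) = EXP (vf a) * EXP (vf b)"
proof -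
  interpret R: plus_subgroup "range vf"
    by (rule vf_subgroup) (unfold_locales, auto)
  have "\<exists>z\<in>range vf. z \<in> F (Suc 0) \<and> EXP z = EXP (vf a) * EXP (- vf (- b))"
  proof (rule texp_quotient_mem[OF R.plus_subgroup_axioms _ vf_mem vf_mem])
    show "vf a - vf (- b) \<in> range vf" by (simp add: R.diff_mem)
  qed (auto simp: vf_commutator)
  then show ?thesis by (auto simp: vf_uminus)
qed

text \<open>If the flows of a and b take the origin to the same point, exp (- a) exp b = exp c fixes
  the origin. Then \<open>vf c\<close> vanishes there, which means c = 0.\<close>

lemma Wf_inj: "inj (Wf mul)"
proof (rule injI)
  fix a b assume eq: "Wf mul a = Wf mul b"
  obtain c where c: "EXP (vf c) = EXP (vf (- a)) * EXP (vf b)" using ex_texp_vf_mult by blast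
  have ab: "EXP (vf a) * EXP (vf c) = EXP (vf b)" "EXP (vf (- a)) * EXP (vf a) = 1"
    using texp_minus[OF vf_mem[of a]] by (simp_all add: c vf_uminus flip: mult.assoc)
  have "zapp (EXP (vf c)) (1, 0) = zapp (EXP (vf (- a)) * EXP (vf a)) (1, 0)"
    by (simp add: c zapp_texp_vf_1 eq)
  then have fixed: "zapp (EXP (vf c)) (1, 0) - (1, 0) \<in> {0}" by (simp add: ab)
  have "zapp (vf c) (1, 0) \<in> {0}"
  proof (rule zapp_texp_diff_mem[OF _ _ vf_power_top _ fixed])
    show "plus_subgroup {0 :: int \<times> 'a}" by unfold_locales auto
    show "E (vf c) 1 = vf c" using dpow_1[OF vf_mem] by simp
  qed simp
  then have "c = 0" by (simp add: zero_prod_def)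
  then have "EXP (vf a) = EXP (vf b)" using ab(1) by simp
  then show "a = b" using texp_inj[OF vf_mem vf_mem] vf_inj by blast
qed

lemma Wf_Omega [simp]: "Wf mul (Omega mul a) = a" and Omega_Wf [simp]: "Omega mul (Wf mul a) = a"
  using Wf_inj surj_f_inv_f[of "Wf mul" a] finite_UNIV_inj_surj[of "Wf mul"]
  by (simp_all add: Omega_def inv_f_f)

definition H :: "'a \<Rightarrow> 'a zendo" where "H a = EXP (vf (Omega mul a))"

lemma zapp_H: "zapp (H a) (1, 0) = (1, a)" "zapp (H a) (1, b) = (1, flow_circ mul a b)"
proof -
  show *: "zapp (H a) (1, 0) = (1, a)" by (simp add: H_def zapp_texp_vf_1)
  show "zapp (H a) (1, b) = (1, flow_circ mul a b)"
    using zapp_add_right[of "H a" "(1, 0)" "(0, b)"] *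
    by (simp add: zapp_texp_vf_0 flow_circ_def) (simp add: H_def zapp_texp_vf_0)
qed

text \<open>The product is the exponential of some \<open>vf c\<close>, and its value at the origin
  identifies \<open>Wf mul c\<close>.\<close>

lemma H_mult: "H (flow_circ mul a b) = H a * H b"
proof -
  obtain c where c: "EXP (vf c) = H a * H b" using ex_texp_vf_mult unfolding H_def by metis
  have "zapp (EXP (vf c)) (1, 0) = (1, flow_circ mul a b)"
    unfolding c zapp_ring_simps zapp_H(1) by (rule zapp_H(2))
  then have "Wf mul c = flow_circ mul a b" by (simp add: zapp_texp_vf_1)
  then have "Omega mul (flow_circ mul a b) = c" by (metis Omega_Wf)
  then show ?thesis by (simp add: H_def[of "flow_circ mul a b"] c)
qed

lemma Omega_0: "Omega mul 0 = 0"
proof -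
  have "zapp (EXP (vf 0)) (1, 0) = (1, 0)" by simp
  then have "Wf mul 0 = 0" by (simp add: zapp_texp_vf_1 del: vf_0)
  then show ?thesis by (metis Omega_Wf)
qed

lemma H_0: "H 0 = 1"
  by (simp add: H_def Omega_0)

lemma H_Wf: "H (Wf mul a) = EXP (vf a)"
  by (simp add: H_def)

lemma is_brace_flow_circ: "is_brace (flow_circ mul)"
  and one_flow_circ: "\<one>\<^bsub>adj_group (flow_circ mul)\<^esub> = 0"
proof -
  have "\<exists>b. H b * H a = 1" for a
    using H_Wf[of "- Omega mul a"] texp_minus(2)[OF vf_mem] by (metis H_def vf_uminus)
  then show "is_brace (flow_circ mul)" "\<one>\<^bsub>adj_group (flow_circ mul)\<^esub> = 0"
    using is_brace_of_representation[of H "flow_circ mul"] H_mult H_0 zapp_H by blast+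
qed

lemma group_adj_flow: "group (adj_group (flow_circ mul))"
  using is_brace_flow_circ by (simp add: is_brace_def)

lemma H_adj_mult: "H (x \<otimes>\<^bsub>adj_group (flow_circ mul)\<^esub> y) = H x * H y"
  by (simp add: adj_group_def H_mult)

lemma H_inj: "H a = H b \<Longrightarrow> a = b"
  using zapp_H(1) by (metis prod.inject)

lemma H_adj_inv: "H (inv\<^bsub>adj_group (flow_circ mul)\<^esub> x) = EXP (- vf (Omega mul x))"
proof -
  interpret G: group "adj_group (flow_circ mul)" by (rule group_adj_flow)
  have "H (Wf mul (- Omega mul x)) = EXP (- vf (Omega mul x))" by (simp add: H_Wf vf_uminus)
  moreover have "inv\<^bsub>adj_group (flow_circ mul)\<^esub> x = Wf mul (- Omega mul x)"
  proof (rule G.inv_equality)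
    show "Wf mul (- Omega mul x) \<otimes>\<^bsub>adj_group (flow_circ mul)\<^esub> x = \<one>\<^bsub>adj_group (flow_circ mul)\<^esub>"
      unfolding one_flow_circ
      by (rule H_inj) (simp add: H_adj_mult H_0 H_Wf vf_uminus H_def[of x] texp_minus vf_mem)
  qed (simp_all add: adj_group_def)
  ultimately show ?thesis by simp
qed

lemma H_adj_pow: "H (x [^]\<^bsub>adj_group (flow_circ mul)\<^esub> (k :: nat)) = H x ^ k"
  by (induction k) (simp_all add: nat_pow_def H_adj_mult one_flow_circ H_0 power_commutes)

section \<open>The ideal p L and powerful groups\<close>

abbreviation "pL \<equiv> vf ` range (nsm p)"

lemma pL_subgroup: "plus_subgroup pL"
proof (rule vf_subgroup, unfold_locales)
  show "0 \<in> range (nsm p :: 'a \<Rightarrow> 'a)" by (metis nsm_zero rangeI)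
qed (auto simp flip: nsm_plus nsm_uminus)

lemma pL_mem: "w \<in> pL \<Longrightarrow> w \<in> F (Suc 0)"
  using vf_mem by auto

lemma pL_normal:
  assumes "w \<in> pL" shows "w * vf a - vf a * w \<in> pL"
proof -
  obtain c where w: "w = vf (nsm p c)" using assms by auto
  have "w * vf a - vf a * w = of_nat p * (vf c * vf a - vf a * vf c)"
    unfolding w vf_nsm by (simp add: right_diff_distrib of_nat_left_commute mult.assoc)
  also have "\<dots> = vf (nsm p (mul c a - mul a c))" by (simp add: vf_commutator vf_nsm)
  finally show ?thesis by auto
qed

lemma pL_bracket: "x \<in> pL \<Longrightarrow> y \<in> pL \<Longrightarrow> x * y - y * x \<in> pL"
  using pL_normal by auto

text \<open>A commutator is exp y' exp (- y), where y' is the conjugate of y by exp x. As [x, y]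
  lies in p L, so does y' - y, hence so does the logarithm of the commutator. Each commutator is
  therefore a single p-th power.\<close>

lemma powerful_group_flow_circ:
  assumes pow: "powerful_pre_lie p mul" shows "powerful_group p (adj_group (flow_circ mul))"
proof -
  let ?G = "adj_group (flow_circ mul)"
  interpret G: group ?G by (rule group_adj_flow)
  have "h1 \<otimes>\<^bsub>?G\<^esub> h2 \<otimes>\<^bsub>?G\<^esub> inv\<^bsub>?G\<^esub> h1 \<otimes>\<^bsub>?G\<^esub> inv\<^bsub>?G\<^esub> h2 \<in> {g [^]\<^bsub>?G\<^esub> p | g. g \<in> carrier ?G}" for h1 h2
  proof -
    define a b where "a = Omega mul h1" and "b = Omega mul h2"
    let ?x = "vf a" and ?y = "vf b"
    let ?y' = "EXP ?x * ?y * EXP (- ?x)"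
    have xy: "?y * - ?x - - ?x * ?y \<in> pL"
    proof -
      obtain c where "mul a b - mul b a = nsm p c" using pow unfolding powerful_pre_lie_def by blast
      then have "?x * ?y - ?y * ?x = vf (nsm p c)" by (simp add: vf_commutator)
      then show ?thesis by simp
    qed
    have "EXP (- (- ?x)) * ?y * EXP (- ?x) - ?y \<in> pL"
    proof (rule texp_conj_mem[OF F_0I[OF vf_mem] _ pL_subgroup xy])
      show "- ?x \<in> F (Suc 0)" using vf_mem[of "- a"] by (simp add: vf_uminus)
      show "w * - ?x - - ?x * w \<in> pL" if "w \<in> pL" for w
        using pL_normal[OF that, of "- a"] by (simp add: vf_uminus)
    qed
    then have y'y: "?y' - ?y \<in> pL" by simp
    have "(?y' - ?y) + ?y \<in> F (Suc 0)" by (intro F_add pL_mem[OF y'y] vf_mem)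
    then have y': "?y' \<in> F (Suc 0)" by simp
    obtain z where z: "z \<in> pL" "EXP z = EXP ?y' * EXP (- ?y)"
      using texp_quotient_mem[OF pL_subgroup pL_bracket y' vf_mem y'y pL_normal] by blast
    have "EXP ?y' = EXP ?x * EXP ?y * EXP (- ?x)"
      by (rule texp_conj) (simp_all add: texp_minus vf_mem)
    then have ez: "EXP z = H h1 * H h2 * EXP (- ?x) * EXP (- ?y)"
      by (simp add: z H_def a_def b_def)
    obtain c where c: "z = of_nat p * vf c" using z(1) by (auto simp: vf_nsm)
    have "H (h1 \<otimes>\<^bsub>?G\<^esub> h2 \<otimes>\<^bsub>?G\<^esub> inv\<^bsub>?G\<^esub> h1 \<otimes>\<^bsub>?G\<^esub> inv\<^bsub>?G\<^esub> h2) = H (Wf mul c [^]\<^bsub>?G\<^esub> p)"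
      unfolding H_adj_mult H_adj_inv H_adj_pow H_Wf
      using ez texp_of_nat_mult[OF vf_mem, of p c] by (simp add: c a_def b_def)
    then show ?thesis using H_inj by (force simp: adj_group_def)
  qed
  then have "derived_set ?G (carrier ?G) \<subseteq> {g [^]\<^bsub>?G\<^esub> p | g. g \<in> carrier ?G}" by blast
  then show ?thesis
    unfolding powerful_group_def derived_def by (rule G.mono_generate)
qed

text \<open>The exponentials of p L form a group containing all p-th powers, hence all commutators
  of the powerful group. The commutator principle then puts each bracket into p L.\<close>

lemma powerful_pre_lie_of_flow_circ:
  assumes pow: "powerful_group p (adj_group (flow_circ mul))" shows "powerful_pre_lie p mul"
proof -
  let ?G = "adj_group (flow_circ mul)"
  interpret G: group ?G by (rule group_adj_flow)
  interpret pL: plus_subgroup pL by (rule pL_subgroup)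
  define K where "K = EXP ` pL"
  have K_1: "1 \<in> K" unfolding K_def using pL.zero_mem texp_zero by (metis imageI)
  have K_mult: "g * h \<in> K" if gh: "g \<in> K" "h \<in> K" for g h
  proof -
    obtain x y where xy: "x \<in> pL" "y \<in> pL" "g = EXP x" "h = EXP y" using gh by (auto simp: K_def)
    have my: "- y \<in> pL" using pL.uminus_mem xy by blast
    have "\<exists>z\<in>pL. z \<in> F (Suc 0) \<and> EXP z = EXP x * EXP (- (- y))"
    proof (rule texp_quotient_mem[OF pL_subgroup pL_bracket pL_mem[OF xy(1)] pL_mem[OF my]])
      show "x - - y \<in> pL" using pL.diff_mem[OF xy(1) my] .
      show "w * - y - - y * w \<in> pL" if "w \<in> pL" for w by (rule pL_bracket[OF that my])
    qed
    then obtain z where "z \<in> pL" "EXP z = g * h" using xy by auto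
    then show ?thesis unfolding K_def by (metis imageI)
  qed
  have gen: "H g \<in> K" if "g \<in> generate ?G {g [^]\<^bsub>?G\<^esub> p | g. g \<in> carrier ?G}" for g
    using that
  proof (induction rule: generate.induct)
    case one
    then show ?case using K_1 by (simp add: one_flow_circ H_0)
  next
    case (incl h)
    then obtain g where "h = g [^]\<^bsub>?G\<^esub> p" by blast
    then have "H h = EXP (of_nat p * vf (Omega mul g))"
      unfolding texp_of_nat_mult[OF vf_mem] H_def[of g, symmetric] by (simp only: H_adj_pow)
    then show ?case by (simp add: K_def flip: vf_nsm)
  next
    case (inv h)
    then obtain g where h: "h = g [^]\<^bsub>?G\<^esub> p" by blast
    then have "H h = EXP (of_nat p * vf (Omega mul g))"
      unfolding texp_of_nat_mult[OF vf_mem] H_def[of g, symmetric] by (simp only: H_adj_pow)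
    then have "H h = H (Wf mul (nsm p (Omega mul g)))" by (simp add: H_Wf vf_nsm)
    then have "h = Wf mul (nsm p (Omega mul g))" by (rule H_inj)
    then have "H (inv\<^bsub>?G\<^esub> h) = EXP (- vf (nsm p (Omega mul g)))" by (simp add: H_adj_inv)
    then show ?case using pL.uminus_mem by (simp add: K_def)
  next
    case (eng h1 h2)
    then show ?case by (simp add: H_adj_mult K_mult)
  qed
  have comm: "EXP (vf a) * EXP (vf b) * EXP (- vf a) * EXP (- vf b) \<in> K" for a b
  proof -
    let ?h = "Wf mul a \<otimes>\<^bsub>?G\<^esub> Wf mul b \<otimes>\<^bsub>?G\<^esub> inv\<^bsub>?G\<^esub> Wf mul a \<otimes>\<^bsub>?G\<^esub> inv\<^bsub>?G\<^esub> Wf mul b"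
    have "?h \<in> derived_set ?G (carrier ?G)" by (auto simp: adj_group_def)
    then have "?h \<in> derived ?G (carrier ?G)" unfolding derived_def by (rule generate.incl)
    then have "H ?h \<in> K" using pow gen unfolding powerful_group_def by blast
    then show ?thesis by (simp add: H_adj_mult H_adj_inv H_Wf)
  qed
  show ?thesis
    unfolding powerful_pre_lie_def
  proof (intro allI)
    fix a b
    have "EXP (vf a * vf b - vf b * vf a) \<in> K"
    proof (rule texp_commutator_mem[OF K_1 K_mult vf_mem vf_mem])
      show "EXP (of_nat s * vf a) * EXP (of_nat s * vf b) * EXP (- (of_nat s * vf a)) * EXP (- (of_nat s * vf b)) \<in> K" for s
        using comm[of "nsm s a" "nsm s b"] by (simp add: vf_nsm)
    qed
    then obtain c where "EXP (vf (mul a b - mul b a)) = EXP (vf (nsm p c))"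
      by (auto simp: K_def vf_commutator)
    then have "mul a b - mul b a = nsm p c" by (intro vf_inj texp_inj[OF vf_mem vf_mem])
    then show "\<exists>c. mul a b - mul b a = nsm p c" ..
  qed
qed

end

section \<open>The Lie ring of a brace\<close>

text \<open>Orbits without fixed points have size divisible by p, so a single fixed point would make
  the size of E congruent to 1 modulo p.\<close>

lemma p_group_action_other_fixed_point:
  assumes "group_action G E \<phi>" and p: "Factorial_Ring.prime p" and order: "order G = p ^ n"
    and E: "finite E" "p dvd card E" and x: "x \<in> E" "\<And>g. g \<in> carrier G \<Longrightarrow> \<phi> g x = x"
  shows "\<exists>y\<in>E. y \<noteq> x \<and> (\<forall>g\<in>carrier G. \<phi> g y = y)"
proof (rule ccontr)
  assume no: "\<not> ?thesis"
  interpret group_action G E \<phi> by fact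
  interpret G: group G using group_hom by (simp add: group_hom_def)
  interpret P: partition E "orbits G E \<phi>" by (rule orbit_partition)
  have "orbit G \<phi> x \<subseteq> {x}" by (auto simp: orbit_def x(2))
  then have orb_x: "orbit G \<phi> x = {x}" using orbit_refl[OF x(1)] by blast
  have dvd: "p dvd card b" if b: "b \<in> orbits G E \<phi> - {{x}}" for b
  proof -
    obtain y where y: "y \<in> E" "b = orbit G \<phi> y" using b unfolding orbits_def by blast
    have "card b dvd p ^ n" using orbit_stabilizer_theorem[OF y(1)] unfolding order y(2) by (metis dvd_triv_left)
    then obtain i where i: "card b = p ^ i" using divides_primepow_nat[OF p] by blast
    have "y \<noteq> x" using b y(2) orb_x by auto
    then obtain g where g: "g \<in> carrier G" "\<phi> g y \<noteq> y" using no y(1) by blast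
    have "y \<in> b" "\<phi> g y \<in> b" using orbit_refl[OF y(1)] g by (auto simp: y(2) orbit_def)
    then have "card b \<noteq> 1" using g(2) by (metis card_1_singletonE singletonD)
    then show ?thesis using i by (cases i) auto
  qed
  have fin: "finite (orbits G E \<phi>)" using E(1) by (simp add: orbits_def)
  have "(\<Sum>b\<in>orbits G E \<phi>. \<Sum>a\<in>b. 1) = (\<Sum>a\<in>E. 1 :: nat)"
    by (rule P.disjoint_sum[OF E(1)])
  then have "card E = (\<Sum>b\<in>orbits G E \<phi>. card b)" by simp
  also have "\<dots> = card {x} + (\<Sum>b\<in>orbits G E \<phi> - {{x}}. card b)"
    using orb_x x(1) fin by (intro sum.remove) (auto simp: orbits_def)
  finally have "card E = 1 + (\<Sum>b\<in>orbits G E \<phi> - {{x}}. card b)" by simp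
  moreover have "p dvd (\<Sum>b\<in>orbits G E \<phi> - {{x}}. card b)" by (rule dvd_sum) (rule dvd)
  ultimately have "p dvd 1" using E(2) by (metis dvd_add_left_iff)
  then show False using p by (simp add: not_prime_unit)
qed

section \<open>Unipotence of the action of the adjoint group\<close>

locale finite_brace =
  fixes circ :: "'a::{finite, ab_group_add} \<Rightarrow> 'a \<Rightarrow> 'a" and p n :: nat
  assumes p_prime: "Factorial_Ring.prime p" and p_large: "2 ^ n < p"
    and card_UNIV: "card (UNIV :: 'a set) = p ^ n"
    and brace: "is_brace circ"
begin

abbreviation "G \<equiv> adj_group circ"

sublocale G: group G using brace by (simp add: is_brace_def)

definition lam :: "'a \<Rightarrow> 'a \<Rightarrow> 'a" where "lam a b = circ a b - a"
definition star :: "'a \<Rightarrow> 'a \<Rightarrow> 'a" where "star a b = lam a b - b"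

lemma circ_eq: "circ a b = a + lam a b" by (simp add: lam_def)

lemma G_simps [simp]: "carrier G = UNIV" "x \<otimes>\<^bsub>G\<^esub> y = circ x y"
  by (simp_all add: adj_group_def)

lemma lam_add: "lam a (b + c) = lam a b + lam a c"
proof -
  have "circ a (b + c) + a = circ a b + circ a c" using brace by (simp add: is_brace_def)
  then show ?thesis by (simp add: lam_def algebra_simps)
qed

lemma lam_0 [simp]: "lam a 0 = 0"
  using lam_add[of a 0 0] by (metis add_cancel_right_right add_0)

lemma lam_diff: "lam a (b - c) = lam a b - lam a c"
  using lam_add[of a "b - c" c] by simp

lemma circ_0 [simp]: "circ a 0 = a"
  by (simp add: circ_eq)

lemma one_eq_0: "\<one>\<^bsub>G\<^esub> = 0"
  using G.l_one[of 0] by simp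

lemma circ_0_left [simp]: "circ 0 a = a"
  using G.l_one[of a] by (simp add: one_eq_0)

lemma lam_0_left [simp]: "lam 0 a = a"
  by (simp add: lam_def)

lemma circ_assoc: "circ (circ a b) c = circ a (circ b c)"
  using G.m_assoc[of a b c] by simp

lemma lam_circ: "lam (circ a b) c = lam a (lam b c)"
proof -
  have "lam a (lam b c) = lam a (circ b c) - lam a b" by (simp add: lam_def[of b] lam_diff)
  then show ?thesis by (simp add: lam_def circ_assoc)
qed

lemma lam_inv: "lam (inv\<^bsub>G\<^esub> a) (lam a b) = b" "lam a (lam (inv\<^bsub>G\<^esub> a) b) = b"
  using G.l_inv[of a] G.r_inv[of a] by (simp_all add: one_eq_0 flip: lam_circ)

lemma star_add: "star a (b + c) = star a b + star a c"
  by (simp add: star_def lam_add)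

lemmas star_chain_subgroup = left_chain_plus_subgroup[of star, OF star_add]

lemma star_chain_mono: "left_chain star k \<subseteq> left_chain star (Suc k)"
  by (rule left_chain_subset_Suc) (simp add: star_def)

text \<open>The adjoint group, a \<open>p\<close>-group, permutes the cosets of the \<open>k\<close>-th term of the chain.\<close>

lemma star_chain_strict:
  assumes eq: "left_chain star (Suc k) = left_chain star k" shows "left_chain star k = UNIV"
proof (rule ccontr)
  assume ne: "left_chain star k \<noteq> UNIV"
  define S where "S = left_chain star k"
  interpret S: plus_subgroup S unfolding S_def by (rule star_chain_subgroup)
  define R where "R = (\<lambda>b. (+) b ` S) ` UNIV"
  have coset: "(+) b ` S = (+) c ` S \<longleftrightarrow> b - c \<in> S" for b c
  proof
    assume "(+) b ` S = (+) c ` S"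
    moreover have "b \<in> (+) b ` S" using S.zero_mem by (auto intro: image_eqI[of _ _ 0])
    ultimately obtain s where "b = c + s" "s \<in> S" by blast
    then show "b - c \<in> S" by simp
  next
    assume bc: "b - c \<in> S"
    have "b + s \<in> (+) c ` S" if "s \<in> S" for s
      using S.add_mem[OF bc that] by (intro image_eqI[of _ _ "b - c + s"]) auto
    moreover have "c + s \<in> (+) b ` S" if "s \<in> S" for s
      using S.diff_mem[OF that bc] by (intro image_eqI[of _ _ "s - (b - c)"]) auto
    ultimately show "(+) b ` S = (+) c ` S" by blast
  qed
  have lam_S: "lam g s \<in> S" if "s \<in> S" for g s
  proof -
    have "star g s \<in> S" using that eq unfolding S_def by auto
    from S.add_mem[OF this that] show ?thesis by (simp add: star_def)
  qed
  have lam_coset: "lam g ` ((+) b ` S) = (+) (lam g b) ` S" for g b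
  proof -
    have "lam g ` S = S"
    proof
      show "S \<subseteq> lam g ` S"
        using lam_S by (auto intro!: image_eqI[of _ _ "lam (inv\<^bsub>G\<^esub> g) _"] simp: lam_inv)
    qed (use lam_S in auto)
    moreover have "lam g ` ((+) b ` S) = (+) (lam g b) ` (lam g ` S)"
      by (simp add: image_image lam_add)
    ultimately show ?thesis by simp
  qed
  define \<phi> where "\<phi> g = restrict ((`) (lam g)) R" for g
  have R_closed: "lam g ` T \<in> R" if "T \<in> R" for g T
    using that lam_coset by (auto simp: R_def)
  have inv_image: "lam g ` (lam (inv\<^bsub>G\<^esub> g) ` T) = T" "lam (inv\<^bsub>G\<^esub> g) ` (lam g ` T) = T" for g T
    by (simp_all add: image_image lam_inv)
  have Bij: "\<phi> g \<in> Bij R" for g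
    unfolding Bij_def \<phi>_def
  proof (intro IntI CollectI)
    have "bij_betw ((`) (lam g)) R R"
      by (rule bij_betw_byWitness[of _ "(`) (lam (inv\<^bsub>G\<^esub> g))"]) (auto simp: inv_image R_closed)
    then show "bij_betw (restrict ((`) (lam g)) R) R R" by (simp cong: bij_betw_cong)
  qed simp
  have "group_action G R \<phi>"
    unfolding group_action_def group_hom_def group_hom_axioms_def
  proof (intro conjI homI)
    show "\<phi> (x \<otimes>\<^bsub>G\<^esub> y) = \<phi> x \<otimes>\<^bsub>BijGroup R\<^esub> \<phi> y" for x y
      using Bij R_closed
      by (auto simp: BijGroup_def \<phi>_def compose_def fun_eq_iff restrict_def lam_circ image_image)
    show "group (BijGroup R)" by (rule group_BijGroup)
    show "group G" by (rule G.group_axioms)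
  qed (simp add: BijGroup_def Bij)
  moreover have "order G = p ^ n" by (simp add: order_def card_UNIV)
  moreover have "finite R" by simp
  moreover have "p dvd card R"
  proof -
    have prod: "card R * card S = p ^ n"
      using card_plus_cosets[OF S.plus_subgroup_axioms] card_UNIV by (simp add: R_def)
    then obtain i where i: "card R = p ^ i" using divides_primepow_nat[OF p_prime] by (metis dvd_triv_left)
    have "card R \<noteq> 1"
    proof
      assume "card R = 1"
      then have "card S = card (UNIV :: 'a set)" using prod card_UNIV by simp
      then have "S = UNIV" by (intro card_subset_eq) auto
      then show False using ne by (simp add: S_def)
    qed
    then show ?thesis using i by (cases i) auto
  qed
  moreover have S_R: "S \<in> R" unfolding R_def by (rule image_eqI[of _ _ 0]) auto
  moreover have "\<phi> g S = S" for g
    using S_R lam_coset[of g 0] by (simp add: \<phi>_def)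
  ultimately obtain T where T: "T \<in> R" "T \<noteq> S" "\<And>g. \<phi> g T = T"
    using p_group_action_other_fixed_point[of G R \<phi> p n S] p_prime by auto
  obtain b where b: "T = (+) b ` S" using T(1) by (auto simp: R_def)
  \<comment> \<open>A fixed coset of b puts b into the next term of the chain, which equals S by
    assumption; the coset is then S itself.\<close>
  have "star g b \<in> S" for g
    using T(3)[of g] T(1) lam_coset[of g b] coset[of "lam g b" b] by (simp add: \<phi>_def b star_def)
  then have "b \<in> S" using eq unfolding S_def by auto
  then have "T = S" using coset[of b 0] by (simp add: b)
  then show False using T(2) by simp
qed

sublocale affine_chain "left_chain star" p n
proof
  show "left_chain star n = UNIV"
    by (rule plus_subgroup_chain_top[where C = "left_chain star", OF p_prime card_UNIV
          star_chain_subgroup star_chain_mono star_chain_strict])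
  show "left_chain star k \<subseteq> left_chain star (Suc k)" for k by (rule star_chain_mono)
  show "nsm (p ^ n) a = 0" for a :: 'a using nsm_card_UNIV[of a] by (simp add: card_UNIV)
qed (simp_all add: p_prime p_large plus_subgroup.zero_mem[OF star_chain_subgroup]
    plus_subgroup.add_mem[OF star_chain_subgroup] plus_subgroup.uminus_mem[OF star_chain_subgroup])

definition H :: "'a \<Rightarrow> 'a zendo" where "H a = zaff 1 a (lam a)"

lemma zapp_H [simp]: "zapp (H a) (k, b) = (k, zmul k a + lam a b)"
  by (simp add: H_def zapp_zaff lam_add)

lemma H_mult: "H a * H b = H (circ a b)"
  by (rule zendo_eqI) (simp_all add: circ_eq[of a b] lam_circ[of a b, unfolded circ_eq[of a b]])

lemma H_0: "H 0 = 1"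
  by (rule zendo_eqI) simp_all

lemma H_inj: assumes "H a = H b" shows "a = b"
proof -
  have "zapp (H c) (1, 0) = (1, c)" for c by simp
  then show ?thesis using assms by (metis prod.inject)
qed

lemma H_mem: "H a - 1 \<in> F (Suc 0)"
proof -
  have "H a - 1 = zaff 0 a (star a)"
  proof -
    have "zapp (zaff 0 a (star a)) (k, b) = (0, zmul k a + star a b)" for k b
      by (simp add: zapp_zaff star_add)
    then show ?thesis by (intro zendo_eqI) (simp_all add: star_def)
  qed
  also have "\<dots> \<in> F (Suc 0)" by (rule zaff_mem) (simp_all add: star_add)
  finally show ?thesis .
qed

lemma range_H: "1 \<in> range H" "g \<in> range H \<Longrightarrow> h \<in> range H \<Longrightarrow> g * h \<in> range H"
  using H_0 by (metis rangeI) (auto simp: H_mult)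

section \<open>Logarithms of the adjoint group\<close>

definition L :: "'a zendo set" where "L = {x \<in> F (Suc 0). EXP x \<in> range H}"

lemma L_subgroup: "plus_subgroup L"
proof
  show "0 \<in> L" by (simp add: L_def F_zero range_H)
  show "x + y \<in> L" if "x \<in> L" "y \<in> L" for x y
    using that texp_sum_mem[OF range_H] F_add by (simp add: L_def)
  show "- x \<in> L" if "x \<in> L" for x
    using that texp_multiple_mem(2)[OF range_H] F_uminus by (simp add: L_def)
qed

lemma L_bracket:
  assumes "x \<in> L" "y \<in> L" shows "x * y - y * x \<in> L"
proof -
  have xy: "x \<in> F (Suc 0)" "y \<in> F (Suc 0)" using assms by (auto simp: L_def)
  have "EXP (x * y - y * x) \<in> range H"
  proof (rule texp_commutator_mem[OF range_H xy])
    fix s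
    have s: "of_nat s * x \<in> L" "of_nat s * y \<in> L"
      using plus_subgroup_of_nat_mult[OF L_subgroup] assms by blast+
    have "z \<in> L \<Longrightarrow> EXP z \<in> range H" for z by (simp add: L_def)
    then show "EXP (of_nat s * x) * EXP (of_nat s * y) * EXP (- (of_nat s * x)) * EXP (- (of_nat s * y)) \<in> range H"
      using plus_subgroup.uminus_mem[OF L_subgroup] s by (intro range_H(2)) auto
  qed
  then show ?thesis
    using F_multI[OF xy, of "Suc 0"] F_multI[OF xy(2,1), of "Suc 0"] by (simp add: L_def F_diff)
qed

lemma zapp_L: "x \<in> L \<Longrightarrow> zapp x u = (0, snd (zapp x u))"
proof -
  assume "x \<in> L"
  then have "zapp x u \<in> B (0 + Suc 0)" using B_0 unfolding L_def F_def by blast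
  then show ?thesis using B_1 by auto
qed

definition base :: "'a zendo \<Rightarrow> 'a" where "base x = snd (zapp x (1, 0))"

text \<open>The exponential of a field in L that vanishes at the origin is some \<open>H a\<close>
  fixing the origin, so a = 0 and the field is 0.\<close>

lemma base_inj: "inj_on base L"
proof (rule inj_onI)
  interpret L: plus_subgroup L by (rule L_subgroup)
  fix x y assume xy: "x \<in> L" "y \<in> L" and eq: "base x = base y"
  define z where "z = x - y"
  have z: "z \<in> L" unfolding z_def using L.diff_mem xy .
  then obtain a where a: "EXP z = H a" by (auto simp: L_def)
  have "base z = 0" using eq by (simp add: z_def base_def)
  then have "zapp z (1, 0) = 0" using zapp_L[OF z, of "(1, 0)"] by (simp add: base_def zero_prod_def)
  then have "zapp (H a) (1, 0) = (1, 0)" using zapp_texp_fixed a by metis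
  then have "EXP z = EXP 0" using a by (simp add: H_0)
  then have "z = 0" using texp_inj z F_zero by (simp add: L_def)
  then show "x = y" by (simp add: z_def)
qed

text \<open>Surjectivity is a count: the exponential maps L bijectively onto \<open>range H\<close>,
  which has as many elements as A.\<close>

lemma base_bij: "bij_betw base L UNIV"
proof -
  have bij: "bij_betw EXP L (range H)"
  proof (rule bij_betwI')
    show "EXP x = EXP y \<longleftrightarrow> x = y" if "x \<in> L" "y \<in> L" for x y
      using that texp_inj by (auto simp: L_def)
    show "\<exists>x\<in>L. g = EXP x" if g: "g \<in> range H" for g
    proof -
      obtain x where "x \<in> F (Suc 0)" "EXP x = g" using texp_surj g H_mem by blast
      then show ?thesis using g by (auto simp: L_def)
    qed
  qed (simp add: L_def)
  have "card L = card (range H)" by (rule bij_betw_same_card[OF bij])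
  moreover have "card (range H) = card (UNIV :: 'a set)"
    by (rule card_image) (rule injI, rule H_inj)
  ultimately have "card (base ` L) = card (UNIV :: 'a set)"
    by (simp add: card_image[OF base_inj])
  then have "base ` L = UNIV" by (intro card_subset_eq) auto
  then show ?thesis using base_inj by (simp add: bij_betw_def)
qed

definition vf :: "'a \<Rightarrow> 'a zendo" where "vf = inv_into L base"

lemma vf_mem: "vf a \<in> L" and base_vf: "base (vf a) = a"
  using base_bij inv_into_into[of a base L] f_inv_into_f[of a base L]
  by (simp_all add: vf_def bij_betw_def)

lemma vf_base: "x \<in> L \<Longrightarrow> vf (base x) = x"
  unfolding vf_def by (rule inv_into_f_f[OF base_inj])

text \<open>The linear part of the unique vector field in L with value a at the origin.\<close>

definition mul :: "'a \<Rightarrow> 'a \<Rightarrow> 'a" where "mul a b = snd (zapp (vf a) (0, b))"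

lemma zapp_vf_1: "zapp (vf a) (1, 0) = (0, a)" and zapp_vf_0: "zapp (vf a) (0, b) = (0, mul a b)"
  using zapp_L[OF vf_mem, of a] base_vf[of a] by (metis base_def, simp add: mul_def)

lemma vf_add: "vf (a + b) = vf a + vf b"
proof -
  have "base (vf a + vf b) = a + b" by (simp add: base_def zapp_vf_1)
  then show ?thesis using vf_base[OF plus_subgroup.add_mem[OF L_subgroup vf_mem vf_mem]] by metis
qed

lemma vf_commutator: "vf a * vf b - vf b * vf a = vf (mul a b - mul b a)"
proof -
  have "base (vf a * vf b - vf b * vf a) = mul a b - mul b a"
    by (simp add: base_def zapp_vf_1 zapp_vf_0)
  then show ?thesis using vf_base[OF L_bracket[OF vf_mem vf_mem]] by metis
qed

lemma mul_add_left: "mul (a + b) c = mul a c + mul b c"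
  by (simp add: mul_def vf_add)

lemma mul_add_right: "mul a (b + c) = mul a b + mul a c"
  using zapp_add_right[of "vf a" "(0, b)" "(0, c)"] by (simp add: zapp_vf_0)

lemma pre_lie_mul: "pre_lie mul"
  unfolding pre_lie_def
proof (intro conjI allI mul_add_left mul_add_right)
  fix x y z
  have "zapp (vf x * vf y - vf y * vf x) (0, z) = zapp (vf (mul x y - mul y x)) (0, z)"
    by (simp add: vf_commutator)
  then have "mul x (mul y z) - mul y (mul x z) = mul (mul x y - mul y x) z"
    by (simp add: zapp_vf_0)
  moreover have "mul (mul x y - mul y x) z + mul (mul y x) z = mul (mul x y) z"
    by (simp flip: mul_add_left)
  ultimately show "mul (mul x y) z - mul x (mul y z) = mul (mul y x) z - mul y (mul x z)"
    by (simp add: algebra_simps)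
qed

text \<open>The second components of \<open>B (n - k)\<close> form term k + 1 of the chain, and
  \<open>vf a\<close>, lying in \<open>F 1\<close>, lowers it by one.\<close>

lemma mul_chain:
  assumes "b \<in> left_chain star (Suc k)" "k \<le> n" shows "mul a b \<in> left_chain star k"
proof -
  have eq: "Suc n - (n - k) = Suc k" using assms(2) by simp
  have "(0, b) \<in> B (n - k)" using assms(1) eq by (simp add: B_def del: left_chain.simps)
  then have "zapp (vf a) (0, b) \<in> B (n - k + Suc 0)"
    using vf_mem[of a] unfolding L_def F_def by blast
  moreover have "Suc n - Suc (n - k) = k" using assms(2) by simp
  ultimately show ?thesis by (simp add: zapp_vf_0 B_def)
qed

lemma rnest_mul_chain: "length as = Suc m \<Longrightarrow> m \<le> n \<Longrightarrow> rnest mul as \<in> left_chain star (n - m)"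
proof (induction m arbitrary: as)
  case 0
  show ?case using C_top by simp
next
  case (Suc m)
  then obtain a bs where as: "as = a # bs" "length bs = Suc m" by (cases as) auto
  then obtain b cs where bs: "bs = b # cs" by (cases bs) auto
  have "rnest mul bs \<in> left_chain star (Suc (n - Suc m))"
    using Suc.IH[OF as(2)] Suc.prems(2) by (simp add: Suc_diff_Suc del: left_chain.simps)
  then show ?case unfolding as(1) bs by (simp only: rnest.simps) (rule mul_chain, simp_all add: bs)
qed

lemma left_nilpotent_mul: "left_nilpotent mul"
proof -
  have "rnest mul as = 0" if "length as = Suc n" for as
    using rnest_mul_chain[OF that order_refl] by simp
  then show ?thesis unfolding left_nilpotent_def by blast
qed

sublocale A: flow_pre_lie mul p n
  by unfold_locales (fact p_prime p_large card_UNIV pre_lie_mul left_nilpotent_mul)+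

text \<open>\<open>A.H a\<close> is the exponential of an element of L, hence some
  \<open>H c\<close>, and the value at the origin forces c = a.\<close>

lemma flow_circ_mul: "flow_circ mul = circ"
proof (intro ext)
  fix a b
  have vf: "A.vf c = vf c" for c
    by (rule zendo_eqI) (simp_all add: zapp_vf_1 zapp_vf_0)
  obtain c where c: "A.H a = H c"
    using vf_mem[of "Omega mul a"] by (auto simp: A.H_def vf L_def)
  have "(1, a) = zapp (H c) (1, 0)" using A.zapp_H(1)[of a] c by simp
  then have "c = a" by simp
  then have "zapp (H a) (1, b) = (1, flow_circ mul a b)" using A.zapp_H(2)[of a b] c by simp
  then show "flow_circ mul a b = circ a b" by (simp add: circ_eq)
qed

end

section \<open>Strong nilpotency\<close>

context flow_pre_lie
begin

lemma mul_nsm_right: "mul a (nsm k b) = nsm k (mul a b)"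
  by (rule nsm_additive) (rule mul_add_right)

lemma mul_nsm_left: "mul (nsm k a) b = nsm k (mul a b)"
  by (rule nsm_additive[of "\<lambda>a. mul a b"]) (rule mul_add_left)

lemma mul_diff_right: "mul a (b - c) = mul a b - mul a c"
  using mul_add_right[of a "b - c" c] by simp

lemma mul_diff_left: "mul (a - b) c = mul a c - mul b c"
  using mul_add_left[of "a - b" b c] by simp

abbreviation "pA \<equiv> range (nsm p :: 'a \<Rightarrow> 'a)"

lemma pA_add: "x \<in> pA \<Longrightarrow> y \<in> pA \<Longrightarrow> x + y \<in> pA"
  by (auto simp flip: nsm_plus)

lemma pA_mul: "x \<in> pA \<Longrightarrow> mul a x \<in> pA" "x \<in> pA \<Longrightarrow> mul x a \<in> pA"
  by (auto simp: mul_nsm_right mul_nsm_left)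

text \<open>Modulo \<open>p\<close> the product is commutative, and a commutative pre-Lie product is associative.\<close>

lemma mul_assoc_mod_p:
  assumes "powerful_pre_lie p mul" shows "mul (mul x y) z - mul x (mul y z) \<in> pA"
proof -
  have comm: "mul a b - mul b a \<in> pA" for a b
    using assms unfolding powerful_pre_lie_def by (metis rangeI)
  have "mul (mul z x - mul x z) y \<in> pA" "mul x (mul z y - mul y z) \<in> pA"
    by (intro pA_mul comm)+
  from pA_add[OF pA_add[OF comm[of "mul x y" z] this(1)] this(2)]
  have "(mul (mul x y) z - mul z (mul x y)) + mul (mul z x - mul x z) y + mul x (mul z y - mul y z) \<in> pA" .
  also have "mul (mul z x - mul x z) y = mul z (mul x y) - mul x (mul z y)"
    using pre_lie_id[of z x y] by (simp add: mul_diff_left algebra_simps)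
  finally show ?thesis by (simp add: mul_diff_right)
qed

lemma rnest_append_mod_p:
  assumes pow: "powerful_pre_lie p mul" and "as \<noteq> []" "bs \<noteq> []"
  shows "mul (rnest mul as) (rnest mul bs) - rnest mul (as @ bs) \<in> pA"
  using assms(2)
proof (induction as)
  case (Cons a as)
  show ?case
  proof (cases "as = []")
    case True
    then show ?thesis using assms(3) rnest_Cons[of bs a] by (auto intro: range_eqI[of _ _ 0])
  next
    case False
    have "mul a (mul (rnest mul as) (rnest mul bs) - rnest mul (as @ bs)) \<in> pA"
      by (intro pA_mul Cons.IH False)
    from pA_add[OF mul_assoc_mod_p[OF pow, of a "rnest mul as" "rnest mul bs"] this]
    have "mul (mul a (rnest mul as)) (rnest mul bs) - mul a (rnest mul (as @ bs)) \<in> pA"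
      by (simp add: mul_diff_right)
    then show ?thesis using rnest_Cons[of as a] rnest_Cons[of "as @ bs" a] False by simp
  qed
qed simp

text \<open>By associativity modulo p all bracketings agree with the right-nested one, the only one
  that left nilpotency controls.\<close>

lemma prod_len_rnest_mod_p:
  assumes pow: "powerful_pre_lie p mul" and "prod_len mul k x"
  shows "\<exists>as. as \<noteq> [] \<and> length as = k \<and> x - rnest mul as \<in> pA"
  using assms(2)
proof (induction rule: prod_len.induct)
  case (single x)
  then show ?case by (intro exI[of _ "[x]"]) (auto intro: range_eqI[of _ _ 0])
next
  case (prod i x j y)
  then obtain as bs where as: "as \<noteq> []" "length as = i" "x - rnest mul as \<in> pA"
    and bs: "bs \<noteq> []" "length bs = j" "y - rnest mul bs \<in> pA" by blast
  have "mul (x - rnest mul as) y \<in> pA" "mul (rnest mul as) (y - rnest mul bs) \<in> pA"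
    by (intro pA_mul as bs)+
  from pA_add[OF pA_add[OF this] rnest_append_mod_p[OF pow as(1) bs(1)]]
  have "mul x y - rnest mul (as @ bs) \<in> pA" by (simp add: mul_diff_left mul_diff_right)
  then show ?case using as bs by (intro exI[of _ "as @ bs"]) auto
qed

lemma rnest_mem_left_chain: "length as = Suc m \<Longrightarrow> rnest mul as \<in> left_chain mul (n - m)"
proof (induction m arbitrary: as)
  case 0
  show ?case using C_top by simp
next
  case (Suc m)
  then obtain a bs where as: "as = a # bs" "length bs = Suc m" by (cases as) auto
  have mem: "rnest mul bs \<in> left_chain mul (n - m)" using Suc.IH[OF as(2)] .
  have "mul a (rnest mul bs) \<in> left_chain mul (n - Suc m)"
  proof (cases "n - m")
    case 0
    then show ?thesis using mem by simp
  next
    case (Suc j)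
    then have "n - Suc m = j" by simp
    then show ?thesis using mem Suc by simp
  qed
  moreover have "bs \<noteq> []" using as by auto
  ultimately show ?case using rnest_Cons as by simp
qed

lemma prod_len_mem_pA:
  assumes "powerful_pre_lie p mul" "prod_len mul k x" "Suc n \<le> k" shows "x \<in> pA"
proof -
  obtain as where as: "length as = k" "x - rnest mul as \<in> pA"
    using prod_len_rnest_mod_p[OF assms(1,2)] by blast
  then have "rnest mul as = 0" using rnest_mem_left_chain[of as "k - 1"] assms(3) by simp
  then show ?thesis using as by simp
qed

text \<open>A long product contains a subproduct whose length lies between \<open>n + 1\<close> and \<open>2 (n + 1)\<close>;
  this subproduct is divisible by \<open>p\<close>.\<close>

lemma prod_len_extract_p:
  assumes pow: "powerful_pre_lie p mul" and "prod_len mul k x" "Suc n \<le> k"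
  shows "\<exists>y j. x = nsm p y \<and> prod_len mul j y \<and> k \<le> j + 2 * Suc n"
  using assms(2,3)
proof (induction rule: prod_len.induct)
  case (single x)
  then obtain y where "x = nsm p y" using prod_len_mem_pA[OF pow prod_len.single] by blast
  then show ?case using prod_len.single[of mul y] by (intro exI[of _ y] exI[of _ 1]) simp
next
  case (prod i x j y)
  consider "Suc n \<le> i" | "Suc n \<le> j" | "i < Suc n" "j < Suc n" by linarith
  then show ?case
  proof cases
    case 1
    then obtain z l where z: "x = nsm p z" "prod_len mul l z" "i \<le> l + 2 * Suc n" using prod.IH by blast
    then show ?thesis using prod_len.prod[OF z(2) prod.hyps(2)]
      by (intro exI[of _ "mul z y"] exI[of _ "l + j"]) (simp add: mul_nsm_left)
  next
    case 2
    then obtain z l where z: "y = nsm p z" "prod_len mul l z" "j \<le> l + 2 * Suc n" using prod.IH by blast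
    then show ?thesis using prod_len.prod[OF prod.hyps(1) z(2)]
      by (intro exI[of _ "mul x z"] exI[of _ "i + l"]) (simp add: mul_nsm_right)
  next
    \<comment> \<open>Both factors are short, so the whole product is a suitable subproduct: at most
      2 n factors give way to the single factor z.\<close>
    case 3
    have "mul x y \<in> pA" using prod_len_mem_pA[OF pow prod_len.prod[OF prod.hyps]] prod.prems .
    then obtain z where "mul x y = nsm p z" by blast
    then show ?thesis using prod_len.single[of mul z] 3 by (intro exI[of _ z] exI[of _ 1]) simp
  qed
qed

lemma strongly_nilpotent_mul:
  assumes pow: "powerful_pre_lie p mul" shows "strongly_nilpotent mul"
proof -
  \<comment> \<open>Each extraction of p costs at most 2 (n + 1) factors. The length 2 (n + 1) (n +
    1) thus allows n extractions, and p^n annihilates A.\<close>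
  have "\<exists>y j. x = nsm (p ^ e) y \<and> prod_len mul j y \<and> k \<le> j + 2 * Suc n * e"
    if "prod_len mul k x" "2 * Suc n * Suc e \<le> k" for e k x
    using that(2)
  proof (induction e)
    case 0
    then show ?case using that(1) by auto
  next
    case (Suc e)
    then obtain y j where y: "x = nsm (p ^ e) y" "prod_len mul j y" "k \<le> j + 2 * Suc n * e" by auto
    have "Suc n \<le> j" using y(3) Suc.prems by simp
    from prod_len_extract_p[OF pow y(2) this] obtain z l
      where z: "y = nsm p z" "prod_len mul l z" "j \<le> l + 2 * Suc n" by blast
    have "x = nsm (p ^ Suc e) z" by (simp add: y z nsm_mult[symmetric] mult.commute)
    then show ?case using y z by (intro exI[of _ z] exI[of _ l]) simp
  qed
  then have "x = 0" if "prod_len mul (2 * Suc n * Suc n) x" for x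
    using that nsm_torsion by fastforce
  then show ?thesis unfolding strongly_nilpotent_def by (intro exI[of _ "2 * Suc n * Suc n"]) auto
qed

end

lemma flow_circ_inj:
  assumes "flow_pre_lie mul1 p n" "flow_pre_lie mul2 p n" and eq: "flow_circ mul1 = flow_circ mul2"
  shows "mul1 = mul2"
proof -
  interpret A: flow_pre_lie mul1 p n by fact
  interpret B: flow_pre_lie mul2 p n by fact
  have H_eq: "A.H a = B.H a" for a
  proof (rule zendo_eqI)
    show "zapp (A.H a) (1, 0) = zapp (B.H a) (1, 0)" by (simp only: A.zapp_H(1) B.zapp_H(1))
    show "zapp (A.H a) (0, b) = zapp (B.H a) (0, b)" for b
      using zapp_diff_right[of "A.H a" "(1, b)" "(1, 0)"] zapp_diff_right[of "B.H a" "(1, b)" "(1, 0)"]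
      by (simp add: A.zapp_H B.zapp_H eq)
  qed
  have vf_eq: "A.vf (Omega mul1 a) = B.vf (Omega mul2 a)" for a
  proof (rule A.texp_inj[OF A.vf_mem])
    let ?y = "B.vf (Omega mul2 a)"
    show e: "A.EXP (A.vf (Omega mul1 a)) = A.EXP ?y"
      using H_eq[of a] by (simp add: A.H_def B.H_def)
    \<comment> \<open>The two products have their own chains, and \<open>texp_inj\<close> needs both
      logarithms in one filtration. The second logarithm enters the first filtration because its
      exponential does.\<close>
    show "?y \<in> A.F (Suc 0)"
    proof (rule A.F_1_I)
      show "?y ^ Suc n = 0" by (rule B.vf_power_top)
      show "A.E ?y 1 = ?y" using B.dpow_1[OF B.vf_mem] by simp
      show "fst (zapp ?y u) = 0" for u by (cases u) simp
      show "A.EXP ?y - 1 \<in> A.F (Suc 0)"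
        unfolding e[symmetric] by (rule A.texp_minus_one_mem[OF A.vf_mem])
    qed
  qed
  have "mul1 a b = mul2 a b" for a b
  proof -
    define c where "c = Wf mul1 a"
    have v: "A.vf a = B.vf (Omega mul2 c)" using vf_eq[of c] by (simp add: c_def)
    have "zapp (A.vf a) (1, 0) = zapp (B.vf (Omega mul2 c)) (1, 0)" by (simp only: v)
    then have "a = Omega mul2 c" by simp
    moreover have "zapp (A.vf a) (0, b) = zapp (B.vf (Omega mul2 c)) (0, b)" by (simp only: v)
    ultimately show ?thesis by simp
  qed
  then show ?thesis by blast
qed

theorem theorem5p2:
  fixes p n :: nat
  assumes "Factorial_Ring.prime p"
    and "card (UNIV :: 'a::{finite, ab_group_add} set) = p ^ n"
    and "p > (n + 1) ^ (n + 1) + 1"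
  shows "(\<forall>mul :: 'a \<Rightarrow> 'a \<Rightarrow> 'a.
            pre_lie mul \<and> left_nilpotent mul \<and> powerful_pre_lie p mul \<longrightarrow>
            is_brace (flow_circ mul) \<and> powerful_group p (adj_group (flow_circ mul)))
       \<and> (\<forall>circ :: 'a \<Rightarrow> 'a \<Rightarrow> 'a.
            is_brace circ \<and> powerful_group p (adj_group circ) \<longrightarrow>
            (\<exists>mul. pre_lie mul \<and> left_nilpotent mul \<and> strongly_nilpotent mul \<and>
                   powerful_pre_lie p mul \<and> flow_circ mul = circ))
       \<and> bij_betw flow_circ
           {mul :: 'a \<Rightarrow> 'a \<Rightarrow> 'a. pre_lie mul \<and> left_nilpotent mul \<and> powerful_pre_lie p mul}
           {circ :: 'a \<Rightarrow> 'a \<Rightarrow> 'a. is_brace circ \<and> powerful_group p (adj_group circ)}"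
proof -
  have small: "2 ^ n < p"
  proof (cases n)
    case 0
    then show ?thesis using assms(3) by simp
  next
    case (Suc m)
    have "(2::nat) ^ n \<le> (n + 1) ^ n" using Suc by (intro power_mono) auto
    also have "\<dots> \<le> (n + 1) ^ (n + 1)" by (intro power_increasing) auto
    finally show ?thesis using assms(3) by simp
  qed
  have flow: "flow_pre_lie mul p n" if "pre_lie mul" "left_nilpotent mul" for mul :: "'a \<Rightarrow> 'a \<Rightarrow> 'a"
    by unfold_locales (fact assms small that)+
  have to_brace: "is_brace (flow_circ mul) \<and> powerful_group p (adj_group (flow_circ mul))"
    if "pre_lie mul \<and> left_nilpotent mul \<and> powerful_pre_lie p mul" for mul :: "'a \<Rightarrow> 'a \<Rightarrow> 'a"
    using flow_pre_lie.is_brace_flow_circ flow_pre_lie.powerful_group_flow_circ flow that by blast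
  have of_brace: "\<exists>mul. pre_lie mul \<and> left_nilpotent mul \<and> strongly_nilpotent mul \<and>
      powerful_pre_lie p mul \<and> flow_circ mul = circ"
    if circ: "is_brace circ \<and> powerful_group p (adj_group circ)" for circ :: "'a \<Rightarrow> 'a \<Rightarrow> 'a"
  proof -
    interpret finite_brace circ p n
      by unfold_locales (use assms small circ in auto)
    have "powerful_pre_lie p mul"
      using A.powerful_pre_lie_of_flow_circ circ by (simp add: flow_circ_mul)
    then show ?thesis
      using A.strongly_nilpotent_mul pre_lie_mul left_nilpotent_mul flow_circ_mul by blast
  qed
  have "bij_betw flow_circ
      {mul :: 'a \<Rightarrow> 'a \<Rightarrow> 'a. pre_lie mul \<and> left_nilpotent mul \<and> powerful_pre_lie p mul}
      {circ :: 'a \<Rightarrow> 'a \<Rightarrow> 'a. is_brace circ \<and> powerful_group p (adj_group circ)}"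
    unfolding bij_betw_def
  proof (intro conjI equalityI subsetI)
    show "inj_on flow_circ {mul :: 'a \<Rightarrow> 'a \<Rightarrow> 'a. pre_lie mul \<and> left_nilpotent mul \<and> powerful_pre_lie p mul}"
      using flow_circ_inj flow by (blast intro: inj_onI)
    show "circ \<in> {circ. is_brace circ \<and> powerful_group p (adj_group circ)}"
      if "circ \<in> flow_circ ` {mul. pre_lie mul \<and> left_nilpotent mul \<and> powerful_pre_lie p mul}"
      for circ :: "'a \<Rightarrow> 'a \<Rightarrow> 'a"
      using that to_brace by auto
    show "circ \<in> flow_circ ` {mul. pre_lie mul \<and> left_nilpotent mul \<and> powerful_pre_lie p mul}"
      if "circ \<in> {circ. is_brace circ \<and> powerful_group p (adj_group circ)}"
      for circ :: "'a \<Rightarrow> 'a \<Rightarrow> 'a"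
      using that of_brace[of circ] by blast
  qed
  then show ?thesis using to_brace of_brace by blast
qed

end
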